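(* Let $X$ be a shift space over a finite alphabet. If $X$ has variable specification, then $X$ is intrinsically ergodic.
   Context: Let $\mathcal A$ be a finite alphabet. A shift space $X\subset\mathcal A^{\mathbb Z}$ is a nonempty closed set invariant under the left shift $\sigma$ (i.e. $\sigma(X)=X$). $\mathcal B_n(X)$ is the set of words of length $n$ occurring in points of $X$, with $\mathcal B_0(X)=\{\varepsilon\}$ ($\varepsilon$ the empty word), and $\mathcal B(X)=\bigcup_{n\ge 0}\mathcal B_n(X)$. For a word $w$ and an integer $n$, $[w]_n=\{x\in X: x_{[n,n+|w|-1]}=w\}$. $X$ has variable specification if there is $N\ge 0$ such that for all $u,v\in\mathcal B(X)$ there is a word $w\in\mathcal B(X)$ of length at most $N$ with $uwv\in\mathcal B(X)$ (in particular $X$ is then irreducible, i.e. any ordered pair $u,v\in\mathcal B(X)$ admits $w\in\mathcal B(X)$ with $uwv\in\mathcal B(X)$). The topological entropy is $h(X)=\lim_{n\to\infty}\frac1n\log|\mathcal B_n(X)|$. For a $\sigma$-invariant Borel probability measure $\mu$ on $X$, the measure-theoretic entropy is $h_\mu(X)=-\lim_{n\to\infty}\frac1n\sum_{w\in\mathcal B_n(X)}\mu([w]_0)\log\mu([w]_0)$ (with $0\log 0=0$). A measure of maximal entropy of $X$ is a $\sigma$-invariant Borel probability measure $\mu$ on $X$ with $h_\mu(X)=h(X)$. $X$ is intrinsically ergodic if it admits exactly one measure of maximal entropy. *)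

theory Defs
  imports "HOL-Probability.Probability"
begin

definition shift :: "(int \<Rightarrow> 'a) \<Rightarrow> (int \<Rightarrow> 'a)" where
  "shift x = (\<lambda>i. x (i + 1))"

definition full_shift_topology :: "'a set \<Rightarrow> (int \<Rightarrow> 'a) topology" where
  "full_shift_topology A = product_topology (\<lambda>_. discrete_topology A) UNIV"

definition shift_space :: "'a set \<Rightarrow> (int \<Rightarrow> 'a) set \<Rightarrow> bool" where
  "shift_space A X \<longleftrightarrow>
     X \<noteq> {} \<and> closedin (full_shift_topology A) X \<and> shift ` X = X"

text \<open>The word \<open>x\<^bsub>[n, n + k - 1]\<^esub>\<close> of length \<open>k\<close>.\<close>

definition block :: "(int \<Rightarrow> 'a) \<Rightarrow> int \<Rightarrow> nat \<Rightarrow> 'a list" where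
  "block x n k = map (\<lambda>i. x (n + int i)) [0..<k]"

definition words :: "nat \<Rightarrow> (int \<Rightarrow> 'a) set \<Rightarrow> 'a list set" where
  "words n X = {block x i n | x i. x \<in> X}"

definition language :: "(int \<Rightarrow> 'a) set \<Rightarrow> 'a list set" where
  "language X = (\<Union>n. words n X)"

definition cylinder :: "(int \<Rightarrow> 'a) set \<Rightarrow> 'a list \<Rightarrow> int \<Rightarrow> (int \<Rightarrow> 'a) set" where
  "cylinder X w n = {x \<in> X. block x n (length w) = w}"

definition variable_specification :: "(int \<Rightarrow> 'a) set \<Rightarrow> bool" where
  "variable_specification X \<longleftrightarrow>
     (\<exists>N::nat. \<forall>u\<in>language X. \<forall>v\<in>language X.
        \<exists>w\<in>language X. length w \<le> N \<and> u @ w @ v \<in> language X)"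

definition topological_entropy :: "(int \<Rightarrow> 'a) set \<Rightarrow> real" where
  "topological_entropy X = lim (\<lambda>n. (1 / real n) * ln (real (card (words n X))))"

definition invariant_measure ::
    "'a set \<Rightarrow> (int \<Rightarrow> 'a) set \<Rightarrow> (int \<Rightarrow> 'a) measure \<Rightarrow> bool" where
  "invariant_measure A X M \<longleftrightarrow>
     space M = X \<and>
     sets M = sigma_sets X {U. openin (subtopology (full_shift_topology A) X) U} \<and>
     prob_space M \<and>
     (\<forall>E\<in>sets M. emeasure M (shift -` E \<inter> space M) = emeasure M E)"

text \<open>The convention \<open>0 log 0 = 0\<close> is automatic because of the factor \<open>0\<close>.\<close>

definition measure_entropy :: "(int \<Rightarrow> 'a) set \<Rightarrow> (int \<Rightarrow> 'a) measure \<Rightarrow> real" where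
  "measure_entropy X M =
     - lim (\<lambda>n. (1 / real n) *
         (\<Sum>w\<in>words n X. measure M (cylinder X w 0) * ln (measure M (cylinder X w 0))))"

definition measure_of_maximal_entropy ::
    "'a set \<Rightarrow> (int \<Rightarrow> 'a) set \<Rightarrow> (int \<Rightarrow> 'a) measure \<Rightarrow> bool" where
  "measure_of_maximal_entropy A X M \<longleftrightarrow>
     invariant_measure A X M \<and> measure_entropy X M = topological_entropy X"

definition intrinsically_ergodic :: "'a set \<Rightarrow> (int \<Rightarrow> 'a) set \<Rightarrow> bool" where
  "intrinsically_ergodic A X \<longleftrightarrow> (\<exists>!M. measure_of_maximal_entropy A X M)"

end

theory Submission
  imports Defs "HOL-Complex_Analysis.Great_Picard"
begin

text \<open>
  Gluing words with gaps of bounded length shows that the number of words of length \<open>n\<close> is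
  \<open>exp (n h)\<close> up to a constant factor. Hence a limit \<open>M\<close> of orbit averages, one orbit per word, gives
  every word of length \<open>n\<close> mass comparable to \<open>exp (- n h)\<close>. The upper bound makes \<open>M\<close> a measure of
  maximal entropy. The lower bound, applied to glued words, gives a lower bound
  \<open>c M(D) M(D')\<close> for the mass of \<open>D\<close> intersected with one of boundedly many preimages of \<open>D'\<close>, for
  clopen \<open>D\<close>, \<open>D'\<close>, so \<open>M\<close> is ergodic. If \<open>Q\<close> is another measure of maximal entropy, its block
  entropies are at least \<open>n h\<close> by subadditivity; comparing with the word count gives
  \<open>- Q(D) ln (M(D)) \<le> C\<close> for all clopen \<open>D\<close>. Therefore \<open>Q\<close> is absolutely continuous with respect
  to the ergodic measure \<open>M\<close>, and the two coincide.
\<close>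

subsection \<open>Subadditive sequences and approximation by an algebra\<close>

text \<open>Specification bounds the length of a gap but does not prescribe it, so gluing fixes
  neither the length of the result nor the position of the second word. The estimates therefore sum
  over the gap lengths from 0 to \<open>N\<close>, which is the origin of the factors
  \<open>N + 1\<close>. Mixing in the usual sense is out of reach: a periodic orbit has variable
  specification. The weaker inequality, with a sum over gaps, still excludes invariant sets of
  intermediate mass. In the uniqueness argument all errors are bounded independently of the window:
  the block entropies of \<open>Q\<close> are at least \<open>n h\<close> with no error at all, and
  the logarithm of the word count exceeds \<open>n h\<close> by at most \<open>ln K\<close>. Thus
  \<open>Q\<close> can afford only a bounded loss of entropy by concentrating on a clopen set,
  however long its words, and the resulting bound survives the approximation of arbitrary null sets
  by clopen ones.\<close>

lemma subadditive_mult: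
  fixes a :: "nat \<Rightarrow> real"
  assumes sub: "\<And>m n. a (m + n) \<le> a m + a n"
  shows "a (Suc k * n) \<le> real (Suc k) * a n"
proof (induction k)
  case (Suc k)
  have "a (Suc (Suc k) * n) \<le> a n + a (Suc k * n)"
    using sub[of n "Suc k * n"] by simp
  with Suc show ?case by (simp add: algebra_simps)
qed simp

text \<open>Along the multiples of \<open>n\<close> the quotients stay below
  \<open>a n / real n\<close>. Convergence is assumed rather than derived because
  \<open>card_words_le\<close> uses a sequence that may be negative, which
  \<open>subadditive_convergent\<close> does not cover.\<close>

lemma subadditive_limit_le:
  fixes a :: "nat \<Rightarrow> real"
  assumes sub: "\<And>m n. a (m + n) \<le> a m + a n"
    and lim: "(\<lambda>n. a n / real n) \<longlonglongrightarrow> l"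
  shows "real n * l \<le> a n"
proof (cases "n = 0")
  case True
  then show ?thesis using sub[of 0 0] by simp
next
  case False
  have "strict_mono (\<lambda>k. Suc k * n)"
    using False by (intro strict_monoI) auto
  then have "(\<lambda>k. a (Suc k * n) / real (Suc k * n)) \<longlonglongrightarrow> l"
    using LIMSEQ_subseq_LIMSEQ[OF lim] unfolding o_def by blast
  moreover have "a (Suc k * n) / real (Suc k * n) \<le> a n / real n" for k
  proof -
    have "a (Suc k * n) / real (Suc k * n) \<le> (real (Suc k) * a n) / real (Suc k * n)"
      by (intro divide_right_mono subadditive_mult sub) auto
    also have "\<dots> = a n / real n"
      by (simp only: of_nat_mult) (metis mult_divide_mult_cancel_left of_nat_neq_0)
    finally show ?thesis .
  qed
  ultimately have "l \<le> a n / real n"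
    by (intro LIMSEQ_le_const2) auto
  then show ?thesis using False by (simp add: field_simps)
qed

text \<open>Fekete's lemma; the limit is the infimum of the quotients over positive indices.\<close>

lemma subadditive_convergent:
  fixes a :: "nat \<Rightarrow> real"
  assumes sub: "\<And>m n. a (m + n) \<le> a m + a n" and nonneg: "\<And>n. 0 \<le> a n"
  shows "convergent (\<lambda>n. a n / real n)"
proof -
  define S where "S = (\<lambda>n. a n / real n) ` {0<..}"
  define l where "l = Inf S"
  have bdd: "bdd_below S"
    unfolding S_def by (rule bdd_belowI[of _ 0]) (auto simp: nonneg)
  have lower: "l \<le> a n / real n" if "n > 0" for n
    unfolding l_def by (intro cInf_lower bdd) (auto simp: S_def that)
  have "(\<lambda>n. a n / real n) \<longlonglongrightarrow> l"
  proof (rule LIMSEQ_I)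
    fix e :: real assume e: "0 < e"
    have "S \<noteq> {}" by (auto simp: S_def)
    then obtain m where m: "m > 0" "a m / real m < l + e / 2"
      using cInf_lessD[of S "l + e/2"] e unfolding l_def[symmetric] by (auto simp: S_def)
    define c where "c = Max (a ` {..<m})"
    have c: "a r \<le> c" if "r < m" for r
      unfolding c_def using that by (intro Max_ge) auto
    have c0: "0 \<le> c" using c[OF m(1)] nonneg[of 0] by linarith
    have upper: "a n \<le> real n * (a m / real m) + c" for n
    proof -
      have "a n \<le> real (n div m) * a m + a (n mod m)"
      \<comment> \<open>Zero full blocks form a separate case: \<open>subadditive_mult\<close>
        covers only positive multiples, since \<open>a 0\<close> may be positive.\<close>
      proof (cases "n div m")
        case 0
        then show ?thesis using m(1) by (simp add: div_eq_0_iff)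
      next
        case (Suc k)
        have "a n = a (Suc k * m + n mod m)" by (metis Suc div_mult_mod_eq)
        also have "\<dots> \<le> a (Suc k * m) + a (n mod m)" by (rule sub)
        also have "\<dots> \<le> real (Suc k) * a m + a (n mod m)"
          using subadditive_mult[of a k m, OF sub] by simp
        finally show ?thesis by (simp add: Suc)
      qed
      also have "real (n div m) * a m \<le> real n / real m * a m"
        using of_nat_div_le_of_nat[of n m, where ?'a = real] nonneg[of m] by (intro mult_right_mono)
      finally show ?thesis using c[of "n mod m"] m(1) by simp
    qed
    obtain n0 :: nat where n0: "c / (e / 2) < real n0" using reals_Archimedean2 by blast
    show "\<exists>no. \<forall>n\<ge>no. norm (a n / real n - l) < e"
    proof (intro exI[of _ "Suc n0"] allI impI)
      fix n assume n: "Suc n0 \<le> n"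
      then have npos: "real n > 0" by auto
      have "c / (e/2) < real n" using n n0 by linarith
      then have "c / real n < e / 2" using npos e by (simp add: field_simps)
      moreover have "a n / real n \<le> a m / real m + c / real n"
        using upper[of n] npos by (simp add: field_simps)
      ultimately have "a n / real n < l + e" using m(2) by linarith
      moreover have "l \<le> a n / real n" using lower npos by simp
      ultimately show "norm (a n / real n - l) < e" by simp
    qed
  qed
  then show ?thesis by (rule convergentI)
qed

text \<open>Gibbs' inequality, from \<open>ln x \<le> x - 1\<close> at \<open>x = q i / p i\<close>.
  As \<open>ln 0\<close> is an ordinary real number, the last assumption excludes zero weights where
  \<open>p\<close> is positive; with the usual conventions the right side would be infinite
  there.\<close>

lemma sum_neg_mult_ln_le:
  fixes p q :: "'b \<Rightarrow> real"
  assumes "finite S" and p: "\<And>i. i \<in> S \<Longrightarrow> 0 \<le> p i" and q: "\<And>i. i \<in> S \<Longrightarrow> 0 \<le> q i"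
    and le: "sum q S \<le> sum p S"
    and zero: "\<And>i. i \<in> S \<Longrightarrow> q i = 0 \<Longrightarrow> p i = 0"
  shows "- (\<Sum>i\<in>S. p i * ln (p i)) \<le> - (\<Sum>i\<in>S. p i * ln (q i))"
proof -
  have "p i * ln (q i) - p i * ln (p i) \<le> q i - p i" if i: "i \<in> S" for i
  proof (cases "p i = 0")
    case False
    then have pos: "p i > 0" "q i > 0" using p q zero i by (auto simp: order_less_le)
    then have "p i * ln (q i / p i) \<le> p i * (q i / p i - 1)"
      by (intro mult_left_mono ln_le_minus_one) auto
    with pos show ?thesis by (simp add: ln_div algebra_simps)
  qed (use q i in auto)
  then have "(\<Sum>i\<in>S. p i * ln (q i) - p i * ln (p i)) \<le> (\<Sum>i\<in>S. q i - p i)"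
    by (rule sum_mono)
  with le show ?thesis by (simp add: sum_subtractf)
qed

text \<open>Two measures are handled at once because absolute continuity needs a single clopen set
  that is close to \<open>E\<close> under both.\<close>

lemma sigma_sets_approximation:
  assumes alg: "algebra \<Omega> G"
    and M: "finite_measure M" "sets M = sigma_sets \<Omega> G"
    and M': "finite_measure M'" "sets M' = sigma_sets \<Omega> G"
    and "E \<in> sigma_sets \<Omega> G" "0 < e"
  shows "\<exists>D\<in>G. measure M (sym_diff E D) < e \<and> measure M' (sym_diff E D) < e"
  using assms(6,7)
proof (induction E arbitrary: e rule: sigma_sets.induct)
  interpret algebra \<Omega> G by (rule alg)
  interpret M: finite_measure M by (rule M)
  interpret M': finite_measure M' by (rule M')
  have GM: "D \<in> sets M" "D \<in> sets M'" if "D \<in> G" for D using that M M' by auto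
  have space: "space M = \<Omega>" "space M' = \<Omega>"
    using M(2) M'(2) space_closed sets_eq_imp_space_eq[of M "sigma \<Omega> G"]
      sets_eq_imp_space_eq[of M' "sigma \<Omega> G"] by auto
  {
    case (Basic a)
    then show ?case by (intro bexI[of _ a]) auto
  next
    case Empty
    then show ?case by (intro bexI[of _ "{}"]) auto
  next
    case (Compl a)
    then obtain D where D: "D \<in> G" "measure M (sym_diff a D) < e" "measure M' (sym_diff a D) < e"
      by blast
    have "a \<subseteq> \<Omega>" using Compl.hyps sigma_sets_into_sp[OF space_closed] by blast
    moreover have "D \<subseteq> \<Omega>" using D space_closed by auto
    ultimately have "sym_diff (\<Omega> - a) (\<Omega> - D) = sym_diff a D" by auto
    with D show ?case by (intro bexI[of _ "\<Omega> - D"]) auto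
  next
    case (Union a)
    define U where "U n = (\<Union>i<n. a i)" for n :: nat
    have aM: "a i \<in> sets M" "a i \<in> sets M'" for i using Union.hyps M M' by auto
    have "\<forall>i. \<exists>D\<in>G. measure M (sym_diff (a i) D) < e / 2 / 2 ^ Suc i \<and>
        measure M' (sym_diff (a i) D) < e / 2 / 2 ^ Suc i"
      using Union by auto
    then obtain D where D: "\<And>i. D i \<in> G" "\<And>i. measure M (sym_diff (a i) (D i)) < e / 2 / 2 ^ Suc i"
      "\<And>i. measure M' (sym_diff (a i) (D i)) < e / 2 / 2 ^ Suc i" by metis
    \<comment> \<open>Half of \<open>e\<close> pays for cutting the union off at \<open>n\<close>,
      the other half, divided geometrically, for replacing each \<open>a i\<close> by
      \<open>D i\<close>. Since the estimate holds for all large \<open>n\<close>, one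
      \<open>n\<close> serves both measures.\<close>
    have key: "\<forall>\<^sub>F n in sequentially. measure L (sym_diff (\<Union> (range a)) (\<Union>i<n. D i)) < e"
      if L: "finite_measure L" "sets L = sigma_sets \<Omega> G"
        and DL: "\<And>i. measure L (sym_diff (a i) (D i)) < e / 2 / 2 ^ Suc i" for L
    proof -
      interpret L: finite_measure L by (rule L)
      have aL: "a i \<in> sets L" for i using Union.hyps L by auto
      have DiL: "D i \<in> sets L" for i using D(1) L by auto
      have "(\<lambda>n. measure L (U n)) \<longlonglongrightarrow> measure L (\<Union>n. U n)"
        using aL by (intro L.finite_Lim_measure_incseq) (fastforce simp: U_def incseq_def)+
      moreover have "(\<Union>n. U n) = \<Union> (range a)" by (auto simp: U_def)
      ultimately have "\<forall>\<^sub>F n in sequentially. measure L (\<Union> (range a)) - e / 2 < measure L (U n)"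
        using Union.prems by (intro order_tendstoD) auto
      then show ?thesis
      proof eventually_elim
        case (elim n)
        have "sym_diff (\<Union> (range a)) (\<Union>i<n. D i) \<subseteq>
            (\<Union> (range a) - U n) \<union> (\<Union>i<n. sym_diff (a i) (D i))"
          by (auto simp: U_def)
        then have "measure L (sym_diff (\<Union> (range a)) (\<Union>i<n. D i)) \<le>
            measure L ((\<Union> (range a) - U n) \<union> (\<Union>i<n. sym_diff (a i) (D i)))"
          using aL DiL by (intro L.finite_measure_mono) (auto simp: U_def)
        also have "\<dots> \<le> measure L (\<Union> (range a) - U n) + measure L (\<Union>i<n. sym_diff (a i) (D i))"
          using aL DiL by (intro measure_Un_le) (auto simp: U_def)
        also have "measure L (\<Union> (range a) - U n) = measure L (\<Union> (range a)) - measure L (U n)"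
          using aL by (intro L.finite_measure_Diff) (auto simp: U_def)
        also have "measure L (\<Union>i<n. sym_diff (a i) (D i)) \<le> (\<Sum>i<n. measure L (sym_diff (a i) (D i)))"
          using aL DiL by (intro measure_UNION_le) auto
        also have "\<dots> \<le> (\<Sum>i<n. e / 2 / 2 ^ Suc i)"
          using DL by (intro sum_mono less_imp_le) auto
        also have "\<dots> = e / 2 * (\<Sum>i<n. (1/2) ^ Suc i)"
          by (simp add: sum_distrib_left power_one_over field_simps)
        also have "(\<Sum>i<n. (1/2::real) ^ Suc i) = 1 - (1/2) ^ n"
          by (induction n) (auto simp: field_simps)
        also have "e / 2 * (1 - (1/2) ^ n) \<le> e / 2" using Union.prems by (simp add: field_simps)
        finally show ?case using elim by simp
      qed
    qed
    have "\<forall>\<^sub>F n in sequentially. measure M (sym_diff (\<Union> (range a)) (\<Union>i<n. D i)) < e \<and>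
        measure M' (sym_diff (\<Union> (range a)) (\<Union>i<n. D i)) < e"
      using key[OF M D(2)] key[OF M' D(3)] by (rule eventually_conj)
    then obtain n where "measure M (sym_diff (\<Union> (range a)) (\<Union>i<n. D i)) < e"
        "measure M' (sym_diff (\<Union> (range a)) (\<Union>i<n. D i)) < e"
      by (auto simp: eventually_sequentially)
    moreover have "(\<Union>i<n. D i) \<in> G" using D(1) by auto
    ultimately show ?case by blast
  }
qed

text \<open>Ergodicity is applied to a single set, the one where the Radon-Nikodym density exceeds
  1. If it is null, \<open>N\<close> is at most \<open>M\<close>; if it has full mass,
  \<open>M\<close> is at most \<open>N\<close>. By passing to complements, either inequality between
  probability measures is an equality.\<close>

lemma ergodic_absolutely_continuous_unique:
  assumes M: "prob_space M" and N: "prob_space N" and sets: "sets N = sets M"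
    and T: "T \<in> measurable M M"
    and invM: "\<And>E. E \<in> sets M \<Longrightarrow> measure M (T -` E \<inter> space M) = measure M E"
    and invN: "\<And>E. E \<in> sets M \<Longrightarrow> measure N (T -` E \<inter> space M) = measure N E"
    and ergodic: "\<And>E. E \<in> sets M \<Longrightarrow> measure M (sym_diff E (T -` E \<inter> space M)) = 0 \<Longrightarrow>
      measure M E = 0 \<or> measure M E = 1"
    and ac: "\<And>E. E \<in> sets M \<Longrightarrow> measure M E = 0 \<Longrightarrow> measure N E = 0"
  shows "N = M"
proof -
  interpret M: prob_space M by (rule M)
  interpret N: prob_space N by (rule N)
  have space: "space N = space M" using sets by (rule sets_eq_imp_space_eq)
  have "absolutely_continuous M N"
    unfolding absolutely_continuous_def using ac sets
    by (auto simp: null_sets_def M.emeasure_eq_measure N.emeasure_eq_measure)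
  then obtain f where f[measurable]: "f \<in> borel_measurable M" and N_eq: "density M f = N"
    using M.Radon_Nikodym sets by blast
  have Nf: "emeasure N S = (\<integral>\<^sup>+x. f x * indicator S x \<partial>M)" if "S \<in> sets M" for S
    using that unfolding N_eq[symmetric] by (intro emeasure_density) auto
  have MI: "emeasure M S = (\<integral>\<^sup>+x. 1 * indicator S x \<partial>M)" if "S \<in> sets M" for S
    using that by simp
  have ge: "measure M S \<le> measure N S" if S: "S \<in> sets M" and "AE x in M. x \<in> S \<longrightarrow> 1 \<le> f x" for S
  proof -
    have "emeasure M S \<le> emeasure N S"
      unfolding Nf[OF S] MI[OF S] using that(2)
      by (intro nn_integral_mono_AE) (auto simp: indicator_def)
    then show ?thesis by (simp add: M.emeasure_eq_measure N.emeasure_eq_measure)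
  qed
  have le: "measure N S \<le> measure M S" if S: "S \<in> sets M" and "AE x in M. x \<in> S \<longrightarrow> f x \<le> 1" for S
  proof -
    have "emeasure N S \<le> emeasure M S"
      unfolding Nf[OF S] MI[OF S] using that(2)
      by (intro nn_integral_mono_AE) (auto simp: indicator_def)
    then show ?thesis by (simp add: M.emeasure_eq_measure N.emeasure_eq_measure)
  qed
  \<comment> \<open>The integral of \<open>f - 1\<close> over \<open>S\<close> is the mass under
    \<open>N\<close> minus the mass under \<open>M\<close>, which truncated subtraction makes 0; but
    the integrand is positive on \<open>S\<close>.\<close>
  have strict: "measure M S = 0" if S: "S \<in> sets M" and gt: "\<And>x. x \<in> S \<Longrightarrow> 1 < f x"
    and NM: "measure N S \<le> measure M S" for S
  proof -
    have fin: "(\<integral>\<^sup>+x. 1 * indicator S x \<partial>M) \<noteq> \<infinity>"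
      unfolding MI[OF S, symmetric] by simp
    have "(\<integral>\<^sup>+x. f x * indicator S x - 1 * indicator S x \<partial>M) = emeasure N S - emeasure M S"
      unfolding Nf[OF S] MI[OF S] using S gt
      by (intro nn_integral_diff) (use fin in \<open>auto simp: indicator_def less_imp_le\<close>)
    also have "\<dots> = 0"
      using NM by (simp add: M.emeasure_eq_measure N.emeasure_eq_measure ennreal_minus_if)
    finally have "AE x in M. f x * indicator S x - 1 * indicator S x = 0"
      using S by (subst (asm) nn_integral_0_iff_AE) auto
    then have "AE x in M. x \<notin> S"
    proof eventually_elim
      case (elim x)
      then show ?case using gt[of x] by (auto simp: diff_eq_0_iff_ennreal)
    qed
    then show ?thesis using S by (simp add: M.prob_eq_0)
  qed
  \<comment> \<open>This set is invariant modulo \<open>M\<close>: its two differences with its preimage have equal mass under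
    \<open>M\<close> and under \<open>N\<close>, while the density exceeds 1 on one and not on the other.\<close>
  define E where "E = {x \<in> space M. 1 < f x}"
  define E' where "E' = T -` E \<inter> space M"
  have E[measurable]: "E \<in> sets M" by (simp add: E_def)
  have E'[measurable]: "E' \<in> sets M" unfolding E'_def using T by measurable
  have diffM: "measure M (E - E') = measure M (E' - E)"
    using invM[OF E] M.finite_measure_Diff'[OF E E'] M.finite_measure_Diff'[OF E' E]
    by (simp add: E'_def Int_commute)
  have diffN: "measure N (E - E') = measure N (E' - E)"
    using invN[OF E] N.finite_measure_Diff'[of E E'] N.finite_measure_Diff'[of E' E] E E' sets
    by (simp add: E'_def Int_commute)
  have "measure N (E' - E) \<le> measure M (E' - E)"
    using E E' by (intro le) (auto simp: E_def)
  then have "measure M (E - E') = 0"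
    using diffM diffN E E' by (intro strict) (auto simp: E_def)
  then have "measure M (sym_diff E E') = 0"
    using diffM measure_Un_le[of "E - E'" M "E' - E"] E E' by (simp add: measure_le_0_iff)
  then consider "measure M E = 0" | "measure M E = 1"
    using ergodic[OF E] by (auto simp: E'_def)
  then have "\<forall>S\<in>sets M. measure N S = measure M S"
  proof cases
    case 1
    then have "AE x in M. x \<notin> E" by (simp add: M.prob_eq_0)
    then have "AE x in M. f x \<le> 1" by (auto simp: E_def not_less)
    then have all: "measure N S \<le> measure M S" if "S \<in> sets M" for S
      using that by (intro le) auto
    show ?thesis
    proof
      fix S assume S: "S \<in> sets M"
      have "measure N (space M - S) \<le> measure M (space M - S)" using S by (intro all) auto
      then show "measure N S = measure M S"
        using all[OF S] M.prob_compl[OF S] N.prob_compl[of S] S sets space by simp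
    qed
  next
    case 2
    then have "AE x in M. x \<in> E" by (simp add: M.prob_eq_1)
    then have "AE x in M. 1 \<le> f x" by eventually_elim (auto simp: E_def)
    then have all: "measure M S \<le> measure N S" if "S \<in> sets M" for S
      using that by (intro ge) auto
    show ?thesis
    proof
      fix S assume S: "S \<in> sets M"
      have "measure M (space M - S) \<le> measure N (space M - S)" using S by (intro all) auto
      then show "measure N S = measure M S"
        using all[OF S] M.prob_compl[OF S] N.prob_compl[of S] S sets space by simp
    qed
  qed
  then show ?thesis
    using sets by (intro measure_eqI) (auto simp: M.emeasure_eq_measure N.emeasure_eq_measure)
qed

subsection \<open>Clopen sets of a subshift\<close>

text \<open>\<open>W\<close> may contain words of any length, occurring in \<open>X\<close> or not.
  Boolean operations over one window are thus the plain ones on \<open>W\<close>, including the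
  complement \<open>- W\<close>.\<close>

definition cyl :: "(int \<Rightarrow> 'a) set \<Rightarrow> int \<Rightarrow> nat \<Rightarrow> 'a list set \<Rightarrow> (int \<Rightarrow> 'a) set" where
  "cyl X n l W = {x \<in> X. block x n l \<in> W}"

definition cyl_sets :: "(int \<Rightarrow> 'a) set \<Rightarrow> (int \<Rightarrow> 'a) set set" where
  "cyl_sets X = {cyl X n l W | n l W. True}"

lemma length_block [simp]: "length (block x n k) = k"
  by (simp add: block_def)

lemma nth_block [simp]: "i < k \<Longrightarrow> block x n k ! i = x (n + int i)"
  by (simp add: block_def)

lemma block_eq_iff: "block x n k = block y m k \<longleftrightarrow> (\<forall>i<k. x (n + int i) = y (m + int i))"
  by (auto simp: list_eq_iff_nth_eq)

lemma block_add: "block x n (k + l) = block x n k @ block x (n + int k) l"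
  by (rule nth_equalityI) (auto simp: nth_append algebra_simps)

lemma take_drop_block: "m + l \<le> k \<Longrightarrow> take l (drop m (block x n k)) = block x (n + int m) l"
  by (rule nth_equalityI) (auto simp: algebra_simps)

lemma block_translate: "block (\<lambda>i. x (i + t)) n k = block x (n + t) k"
  by (rule nth_equalityI) (auto simp: algebra_simps)

lemma cylinder_eq_cyl: "cylinder X w n = cyl X n (length w) {w}"
  by (simp add: cylinder_def cyl_def)

lemma cyl_enlarge:
  assumes "m \<le> n" "n + int l \<le> m + int k"
  shows "cyl X n l W = cyl X m k {z. take l (drop (nat (n - m)) z) \<in> W}"
  using assms by (auto simp: cyl_def take_drop_block)

lemma cyl_Un: "cyl X n l W \<union> cyl X n l V = cyl X n l (W \<union> V)"
  by (auto simp: cyl_def)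

lemma cyl_Compl: "X - cyl X n l W = cyl X n l (- W)"
  by (auto simp: cyl_def)

lemma cyl_in_cyl_sets [intro]: "cyl X n l W \<in> cyl_sets X"
  by (auto simp: cyl_sets_def)

lemma cylinder_in_cyl_sets [intro]: "cylinder X w n \<in> cyl_sets X"
  by (auto simp: cylinder_eq_cyl)

text \<open>For unions, both sets are rewritten over the smallest window that contains the two given
  ones.\<close>

lemma algebra_cyl_sets: "algebra X (cyl_sets X)"
proof (subst algebra_iff_Un, intro conjI ballI)
  show "cyl_sets X \<subseteq> Pow X" by (auto simp: cyl_sets_def cyl_def)
  have "cyl X 0 0 {} = {}" by (auto simp: cyl_def)
  then show "{} \<in> cyl_sets X" by (metis cyl_in_cyl_sets)
next
  fix a assume "a \<in> cyl_sets X"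
  then obtain n l W where "a = cyl X n l W" by (auto simp: cyl_sets_def)
  then show "X - a \<in> cyl_sets X" by (simp add: cyl_Compl cyl_in_cyl_sets)
next
  fix a b assume "a \<in> cyl_sets X" "b \<in> cyl_sets X"
  then obtain n l W n' l' W' where ab: "a = cyl X n l W" "b = cyl X n' l' W'"
    by (auto simp: cyl_sets_def)
  define m where "m = min n n'"
  define k where "k = nat (max (n + int l) (n' + int l') - m)"
  have k: "int k = max (n + int l) (n' + int l') - m" by (auto simp: k_def m_def)
  have "a = cyl X m k {z. take l (drop (nat (n - m)) z) \<in> W}"
    "b = cyl X m k {z. take l' (drop (nat (n' - m)) z) \<in> W'}"
    unfolding ab using k by (auto intro!: cyl_enlarge simp: m_def)
  then show "a \<union> b \<in> cyl_sets X" by (auto simp: cyl_Un)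
qed

section \<open>Words and topology of a subshift\<close>

locale subshift =
  fixes A :: "'a set" and X :: "(int \<Rightarrow> 'a) set"
  assumes finite_alphabet: "finite A" and shift_space: "shift_space A X"
begin

lemma nonempty: "X \<noteq> {}" and closed: "closedin (full_shift_topology A) X"
  and shift_image: "shift ` X = X"
  using shift_space by (auto simp: shift_space_def)

lemma subset_alphabet: "x \<in> X \<Longrightarrow> x i \<in> A"
  using closedin_subset[OF closed] by (auto simp: full_shift_topology_def PiE_iff)

lemma translate_in: "x \<in> X \<Longrightarrow> (\<lambda>i. x (i + t)) \<in> X"
proof (induction t rule: int_induct[where k = 0])
  case (step1 t)
  then have "shift (\<lambda>i. x (i + t)) \<in> X" using shift_image by blast
  then show ?case by (simp add: shift_def ac_simps)
next
  \<comment> \<open>Surjectivity of the shift on \<open>X\<close> yields a preimage inside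
    \<open>X\<close>, and injectivity forces it to be the backward translate.\<close>
  case (step2 t)
  then obtain y where y: "y \<in> X" "(\<lambda>i. x (i + t)) = shift y" using shift_image by blast
  have "y = (\<lambda>i. x (i + (t - 1)))"
  proof
    fix i
    show "y i = x (i + (t - 1))"
      using fun_cong[OF y(2), of "i - 1"] by (simp add: shift_def algebra_simps)
  qed
  with y show ?case by simp
qed simp

lemma words_eq: "words k X = (\<lambda>x. block x n k) ` X"
proof
  show "words k X \<subseteq> (\<lambda>x. block x n k) ` X"
  proof
    fix w assume "w \<in> words k X"
    then obtain x i where x: "x \<in> X" "w = block x i k" by (auto simp: words_def)
    then show "w \<in> (\<lambda>x. block x n k) ` X"
      using translate_in[OF x(1), of "i - n"] by (intro image_eqI[where x = "\<lambda>j. x (j + (i - n))"])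
        (auto simp: block_translate)
  qed
qed (auto simp: words_def)

lemma block_in_words [intro]: "x \<in> X \<Longrightarrow> block x n k \<in> words k X"
  by (auto simp: words_def)

lemma length_words: "w \<in> words k X \<Longrightarrow> length w = k"
  by (auto simp: words_def)

lemma finite_words [simp]: "finite (words k X)"
proof (rule finite_subset)
  show "words k X \<subseteq> {w. set w \<subseteq> A \<and> length w = k}"
    using subset_alphabet by (auto simp: words_def block_def)
qed (rule finite_lists_length_eq[OF finite_alphabet])

lemma words_nonempty [simp]: "words k X \<noteq> {}"
  using nonempty words_eq[of k 0] by auto

lemma language_iff: "w \<in> language X \<longleftrightarrow> w \<in> words (length w) X"
  using length_words by (auto simp: language_def)

lemma take_drop_words:
  assumes "w \<in> words k X" "m + l \<le> k"
  shows "take l (drop m w) \<in> words l X"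
proof -
  obtain x i where "x \<in> X" "w = block x i k" using assms(1) by (auto simp: words_def)
  then show ?thesis using assms(2) by (auto simp: take_drop_block)
qed

lemma take_words: "w \<in> words (m + n) X \<Longrightarrow> take m w \<in> words m X"
  using take_drop_words[of w "m + n" 0 m] by simp

lemma drop_words: "w \<in> words (m + n) X \<Longrightarrow> drop m w \<in> words n X"
  using take_drop_words[of w "m + n" m n] length_words[of w] by simp

lemma extend_word:
  assumes "w \<in> words m X"
  obtains e where "length e = n" "w @ e \<in> words (m + n) X"
proof -
  obtain x where "x \<in> X" "w = block x 0 m" using assms words_eq[of m 0] by auto
  then show thesis
    using that[of "block x (int m) n"] block_add[of x 0 m n] block_in_words[of x 0 "m + n"] by simp
qed

text \<open>Countability makes open sets countable unions of cylinder sets, and permits a diagonal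
  subsequence in \<open>exists_gibbs_measure\<close>. Cutting \<open>W\<close> down to the finitely
  many words of length \<open>l\<close> leaves countably many descriptions.\<close>

lemma countable_cyl_sets: "countable (cyl_sets X)"
proof -
  have "cyl_sets X \<subseteq> (\<lambda>(n, l, W). cyl X n l W) ` (UNIV \<times> (SIGMA l:UNIV. Pow (words l X)))"
  proof
    fix c assume "c \<in> cyl_sets X"
    then obtain n l W where "c = cyl X n l W" by (auto simp: cyl_sets_def)
    then have "c = cyl X n l (W \<inter> words l X)" by (auto simp: cyl_def)
    then show "c \<in> (\<lambda>(n, l, W). cyl X n l W) ` (UNIV \<times> (SIGMA l:UNIV. Pow (words l X)))"
      by (intro image_eqI[where x = "(n, l, W \<inter> words l X)"]) auto
  qed
  moreover have "countable (UNIV \<times> (SIGMA l:UNIV. Pow (words l X)) :: (int \<times> nat \<times> 'a list set) set)"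
    by (intro countable_SIGMA) (auto intro: countable_finite)
  ultimately show ?thesis by (meson countable_image countable_subset)
qed

lemma openin_cyl: "openin (subtopology (full_shift_topology A) X) (cyl X n l W)"
proof -
  let ?T = "full_shift_topology A"
  have coord: "openin ?T {y \<in> topspace ?T. y i \<in> {b}}" if "b \<in> A" for i b
  proof -
    have "continuous_map ?T (discrete_topology A) (\<lambda>y. y i)"
      unfolding full_shift_topology_def by (rule continuous_map_product_projection) simp
    then show ?thesis by (rule openin_continuous_map_preimage) (simp add: that)
  qed
  have single: "openin (subtopology ?T X) (cyl X n l {block x n l})" if x: "x \<in> X" for x
  proof -
    let ?U = "topspace ?T \<inter> (\<Inter>i<l. {y \<in> topspace ?T. y (n + int i) \<in> {x (n + int i)}})"
    have "openin ?T ?U"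
    proof (cases "l = 0")
      case False
      then show ?thesis using coord subset_alphabet[OF x] by (intro openin_Int openin_INT2) auto
    qed simp
    moreover have "cyl X n l {block x n l} = ?U \<inter> X"
      using closedin_subset[OF closed] by (auto simp: cyl_def block_eq_iff)
    ultimately show ?thesis by (auto simp: openin_subtopology)
  qed
  have "cyl X n l W = (\<Union>x\<in>cyl X n l W. cyl X n l {block x n l})" by (auto simp: cyl_def)
  also have "openin (subtopology ?T X) \<dots>"
    using single by (intro openin_Union) (auto simp: cyl_def)
  finally show ?thesis .
qed

lemma topspace_subshift: "topspace (subtopology (full_shift_topology A) X) = X"
  using closedin_subset[OF closed] by auto

lemma closedin_cyl: "closedin (subtopology (full_shift_topology A) X) (cyl X n l W)"
  unfolding closedin_def topspace_subshift cyl_Compl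
  by (auto simp: openin_cyl) (auto simp: cyl_def)

lemma compact_subshift: "compact_space (subtopology (full_shift_topology A) X)"
proof -
  have "compact_space (full_shift_topology A)"
    unfolding full_shift_topology_def
    by (simp add: compact_space_product_topology compact_space_discrete_topology finite_alphabet)
  then have "compactin (full_shift_topology A) X"
    by (rule closedin_compact_space) (rule closed)
  then show ?thesis by (rule compact_space_subtopology)
qed

lemma open_contains_cyl:
  assumes U: "openin (subtopology (full_shift_topology A) X) U" and x: "x \<in> U"
  shows "\<exists>k. cyl X (- int k) (2 * k) {block x (- int k) (2 * k)} \<subseteq> U"
proof -
  obtain V where V: "openin (full_shift_topology A) V" "U = V \<inter> X"
    using U by (auto simp: openin_subtopology)
  then obtain B where B: "x \<in> (\<Pi>\<^sub>E i\<in>UNIV. B i)" "finite {i. B i \<noteq> A}" "(\<Pi>\<^sub>E i\<in>UNIV. B i) \<subseteq> V"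
    using product_topology_open_contains_basis[of "\<lambda>_. discrete_topology A" UNIV V x] x
    unfolding full_shift_topology_def by auto
  \<comment> \<open>The bound is strict because the window of length \<open>2 * k\<close> that
    starts at \<open>- k\<close> ends at \<open>k - 1\<close>.\<close>
  obtain k where k: "\<And>i. B i \<noteq> A \<Longrightarrow> \<bar>i\<bar> < int k"
  proof -
    obtain b where "\<forall>z\<in>(\<lambda>i. nat \<bar>i\<bar>) ` {i. B i \<noteq> A}. z \<le> b"
      using B(2) finite_nat_set_iff_bounded_le by blast
    then show thesis by (intro that[of "Suc b"]) auto
  qed
  have "cyl X (- int k) (2 * k) {block x (- int k) (2 * k)} \<subseteq> U"
  proof
    fix y assume "y \<in> cyl X (- int k) (2 * k) {block x (- int k) (2 * k)}"
    then have y: "y \<in> X" and eq: "\<And>i. i < 2 * k \<Longrightarrow> y (- int k + int i) = x (- int k + int i)"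
      by (auto simp: cyl_def block_eq_iff)
    have "y i \<in> B i" for i
    proof (cases "B i = A")
      case False
      then have "- int k + int (nat (i + int k)) = i" "nat (i + int k) < 2 * k"
        using k[of i] by auto
      then have "y i = x i" using eq by metis
      then show ?thesis using B(1) by auto
    qed (use y subset_alphabet in auto)
    then show "y \<in> U" using B(3) V(2) y by auto
  qed
  then show ?thesis by blast
qed

text \<open>Replaces the Borel sets in \<open>invariant_measure\<close> by the sigma-algebra of an
  algebra, on which measures can be built, compared and approximated.\<close>

lemma sigma_sets_cyl:
  "sigma_sets X {U. openin (subtopology (full_shift_topology A) X) U} = sigma_sets X (cyl_sets X)"
proof (rule sigma_sets_eqI)
  fix U assume "U \<in> {U. openin (subtopology (full_shift_topology A) X) U}"
  then have U: "openin (subtopology (full_shift_topology A) X) U" by simp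
  define I where "I = {c \<in> cyl_sets X. c \<subseteq> U}"
  have "U \<subseteq> \<Union> I"
  proof
    fix x assume x: "x \<in> U"
    then have "x \<in> X" using openin_subset[OF U] by auto
    then have "x \<in> cyl X (- int k) (2 * k) {block x (- int k) (2 * k)}" for k
      by (simp add: cyl_def)
    with open_contains_cyl[OF U x] show "x \<in> \<Union> I"
      unfolding I_def by blast
  qed
  then have "U = \<Union> I" by (auto simp: I_def)
  moreover have "countable I"
    unfolding I_def by (rule countable_subset[OF _ countable_cyl_sets]) auto
  moreover have "\<And>c. c \<in> I \<Longrightarrow> c \<in> sigma_sets X (cyl_sets X)" by (auto simp: I_def)
  ultimately show "U \<in> sigma_sets X (cyl_sets X)"
    using sigma_sets_UNION[of I X "cyl_sets X"] by simp
next
  fix c assume "c \<in> cyl_sets X"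
  then show "c \<in> sigma_sets X {U. openin (subtopology (full_shift_topology A) X) U}"
    using openin_cyl by (auto simp: cyl_sets_def)
qed

subsection \<open>Counting words\<close>

lemma card_words_pos: "0 < card (words n X)"
  using words_nonempty by (simp add: card_gt_0_iff)

lemma card_words_add_le: "card (words (m + n) X) \<le> card (words m X) * card (words n X)"
proof -
  have "card (words (m + n) X) \<le> card (words m X \<times> words n X)"
  proof (rule card_inj_on_le[where f = "\<lambda>w. (take m w, drop m w)"])
    show "inj_on (\<lambda>w. (take m w, drop m w)) (words (m + n) X)"
      by (rule inj_onI) (metis append_take_drop_id prod.inject)
  qed (auto intro: take_words drop_words)
  then show ?thesis by (simp add: card_cartesian_product)
qed

lemma ln_card_words_add_le:
  "ln (real (card (words (m + n) X))) \<le> ln (real (card (words m X))) + ln (real (card (words n X)))"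
proof -
  have "ln (real (card (words (m + n) X))) \<le> ln (real (card (words m X)) * real (card (words n X)))"
    using card_words_add_le[of m n] card_words_pos
    by (subst ln_le_cancel_iff) (simp_all flip: of_nat_mult of_nat_le_iff)
  then show ?thesis using card_words_pos by (simp add: ln_mult)
qed

text \<open>The value of \<open>lim\<close> is meaningful only for convergent sequences; Fekete's
  lemma supplies the convergence.\<close>

lemma topological_entropy_limit:
  "(\<lambda>n. ln (real (card (words n X))) / real n) \<longlonglongrightarrow> topological_entropy X"
proof -
  have "convergent (\<lambda>n. ln (real (card (words n X))) / real n)"
    using card_words_pos
    by (intro subadditive_convergent ln_card_words_add_le ln_ge_zero) (simp add: Suc_le_eq)
  then show ?thesis
    by (simp add: topological_entropy_def convergent_LIMSEQ_iff mult.commute divide_inverse)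
qed

lemma exp_entropy_le_card_words: "exp (real n * topological_entropy X) \<le> real (card (words n X))"
proof -
  have "real n * topological_entropy X \<le> ln (real (card (words n X)))"
    using subadditive_limit_le[OF ln_card_words_add_le topological_entropy_limit] .
  then show ?thesis using card_words_pos[of n] by (simp add: ln_ge_iff)
qed

end

section \<open>Word counts under variable specification\<close>

locale specified_subshift = subshift A X for A :: "'a set" and X +
  fixes N :: nat
  assumes spec: "\<And>u v. u \<in> language X \<Longrightarrow> v \<in> language X \<Longrightarrow>
    \<exists>w\<in>language X. length w \<le> N \<and> u @ w @ v \<in> language X"
begin

lemma glue:
  assumes "u \<in> words m X" "v \<in> words n X"
  shows "\<exists>w. length w \<le> N \<and> u @ w @ v \<in> words (m + length w + n) X"
proof -
  have "u \<in> language X" "v \<in> language X" using assms by (auto simp: language_def)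
  then obtain w where w: "length w \<le> N" "u @ w @ v \<in> language X" using spec by blast
  then show ?thesis using assms length_words unfolding language_iff
    by (intro exI[of _ w]) (auto simp: ac_simps)
qed

lemma card_words_mult_le_count:
  assumes w: "w \<in> words n X"
  shows "card (words s X) * card (words t X) \<le>
    (N + 1) * (\<Sum>j\<le>N. card {z \<in> words (s + n + t + 2 * N) X. take n (drop (s + j) z) = w})"
proof -
  \<comment> \<open>The word \<open>z = a g w g' b e\<close> with gaps of lengths \<open>j\<close>, \<open>k\<close> determines \<open>(a, b)\<close> once \<open>(j, k)\<close> is known.\<close>
  define P where "P = (\<lambda>(a, b) (j, k, z). j \<le> N \<and> k \<le> N \<and> z \<in> words (s + n + t + 2 * N) X \<and>
    take s z = a \<and> take n (drop (s + j) z) = w \<and> take t (drop (s + j + n + k) z) = b)"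
  have "\<exists>q. P p q" if pair: "p \<in> words s X \<times> words t X" for p
  proof -
    obtain a b where p: "p = (a, b)" "a \<in> words s X" "b \<in> words t X" using pair by auto
    obtain g where g: "length g \<le> N" "a @ g @ w \<in> words (s + length g + n) X"
      using glue[OF p(2) w] by blast
    obtain g' where g': "length g' \<le> N"
      "(a @ g @ w) @ g' @ b \<in> words (s + length g + n + length g' + t) X"
      using glue[OF g(2) p(3)] by blast
    obtain e where e: "length e = 2 * N - length g - length g'"
      "((a @ g @ w) @ g' @ b) @ e \<in> words (s + length g + n + length g' + t + (2 * N - length g - length g')) X"
      using extend_word[OF g'(2)] by blast
    have "s + length g + n + length g' + t + (2 * N - length g - length g') = s + n + t + 2 * N"
      using g g' by simp
    then have "P p (length g, length g', ((a @ g @ w) @ g' @ b) @ e)"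
      using p g g' e length_words[OF p(2)] length_words[OF p(3)] length_words[OF w] by (simp add: P_def add.assoc)
    then show ?thesis by blast
  qed
  then obtain q where q: "\<And>p. p \<in> words s X \<times> words t X \<Longrightarrow> P p (q p)" by metis
  let ?S = "SIGMA j:{..N}. {..N} \<times> {z \<in> words (s + n + t + 2 * N) X. take n (drop (s + j) z) = w}"
  have "card (words s X \<times> words t X) \<le> card ?S"
  proof (rule card_inj_on_le[where f = q])
    show "inj_on q (words s X \<times> words t X)"
    proof (rule inj_onI)
      fix p p' assume "p \<in> words s X \<times> words t X" "p' \<in> words s X \<times> words t X" "q p = q p'"
      then show "p = p'" using q[of p] q[of p'] by (auto simp: P_def split: prod.splits)
    qed
    show "q ` (words s X \<times> words t X) \<subseteq> ?S" 
    proof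
      fix y assume "y \<in> q ` (words s X \<times> words t X)"
      then obtain p where "p \<in> words s X \<times> words t X" "y = q p" by auto
      then show "y \<in> ?S" using q[of p] by (auto simp: P_def split: prod.splits)
    qed
  qed simp
  also have "card ?S = (\<Sum>j\<le>N. (N + 1) * card {z \<in> words (s + n + t + 2 * N) X. take n (drop (s + j) z) = w})"
    by (simp add: card_SigmaI card_cartesian_product)
  finally show ?thesis by (simp add: card_cartesian_product sum_distrib_left)
qed

text \<open>The two gap lengths cost \<open>N + 1\<close> each, and removing \<open>2 * N\<close>
  letters of padding costs the number of words of that length.\<close>

definition K :: real where
  "K = real (N + 1) * (real (N + 1) * real (card (words (2 * N) X)))"

lemma K_pos: "0 < K"
  using card_words_pos[of "2 * N"] by (simp add: K_def)

lemma card_words_mult_le: "real (card (words m X)) * real (card (words n X)) \<le> K * real (card (words (m + n) X))"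
proof -
  \<comment> \<open>The empty word occurs at every position, so the counting lemma then counts all
    words.\<close>
  have "[] \<in> words 0 X" using words_nonempty[of 0] length_words by fastforce
  then have "card (words m X) * card (words n X) \<le>
      (N + 1) * (\<Sum>j\<le>N. card {z \<in> words (m + 0 + n + 2 * N) X. take 0 (drop (m + j) z) = []})"
    by (rule card_words_mult_le_count)
  also have "\<dots> = (N + 1) * ((N + 1) * card (words (m + n + 2 * N) X))" by simp
  also have "\<dots> \<le> (N + 1) * ((N + 1) * (card (words (m + n) X) * card (words (2 * N) X)))"
    by (intro mult_left_mono card_words_add_le) auto
  finally have "real (card (words m X) * card (words n X)) \<le>
      real ((N + 1) * ((N + 1) * (card (words (m + n) X) * card (words (2 * N) X))))"
    by (rule of_nat_mono)
  then show ?thesis unfolding K_def of_nat_mult by (simp only: ac_simps)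
qed

text \<open>Supermultiplicativity up to \<open>K\<close> makes
  \<open>ln K - ln (card (words n X))\<close> subadditive, with quotients tending to
  \<open>- topological_entropy X\<close>.\<close>

lemma card_words_le: "real (card (words n X)) \<le> K * exp (real n * topological_entropy X)"
proof -
  define a where "a n = ln K - ln (real (card (words n X)))" for n
  have "a (m + n) \<le> a m + a n" for m n
  proof -
    have "ln (real (card (words m X)) * real (card (words n X))) \<le> ln (K * real (card (words (m + n) X)))"
      using card_words_mult_le[of m n] card_words_pos K_pos by (subst ln_le_cancel_iff) auto
    then show ?thesis using card_words_pos K_pos by (simp add: ln_mult a_def)
  qed
  moreover have "(\<lambda>n. a n / real n) \<longlonglongrightarrow> 0 - topological_entropy X"
    unfolding a_def diff_divide_distrib
    by (intro tendsto_diff topological_entropy_limit lim_const_over_n)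
  ultimately have "real n * (0 - topological_entropy X) \<le> a n"
    by (rule subadditive_limit_le)
  then have "ln (real (card (words n X))) \<le> ln (K * exp (real n * topological_entropy X))"
    using K_pos by (simp add: a_def ln_mult)
  then show ?thesis using card_words_pos K_pos by (subst (asm) ln_le_cancel_iff) auto
qed

end

context subshift
begin

subsection \<open>A Gibbs measure\<close>

lemma block_shift: "block (shift x) n l = block x (n + 1) l"
  by (simp add: shift_def block_translate)

lemma shift_in: "x \<in> X \<Longrightarrow> shift x \<in> X"
  using shift_image by blast

lemma shift_vimage_cyl: "shift -` cyl X n l W \<inter> X = cyl X (n + 1) l W"
  by (auto simp: cyl_def block_shift shift_in)

text \<open>Coordinates outside the window of \<open>v\<close> are uncontrolled. Blocks that leave
  this window cause the error \<open>n / L\<close> in \<open>empirical_cylinder_le\<close>.\<close>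

definition point :: "'a list \<Rightarrow> int \<Rightarrow> 'a" where
  "point v = (SOME x. x \<in> X \<and> block x 0 (length v) = v)"

lemma point:
  assumes "v \<in> words n X"
  shows "point v \<in> X" "block (point v) 0 n = v"
proof -
  have "\<exists>x. x \<in> X \<and> block x 0 (length v) = v"
    using assms length_words[OF assms] words_eq[of n 0] by auto
  then show "point v \<in> X" "block (point v) 0 n = v"
    using someI_ex[of "\<lambda>x. x \<in> X \<and> block x 0 (length v) = v"] length_words[OF assms]
    by (auto simp: point_def)
qed

text \<open>The additive set functions whose limit along a subsequence is the measure of maximal entropy;
  the junk value at \<open>L = 0\<close> is \<open>0\<close>.\<close>

definition empirical :: "nat \<Rightarrow> (int \<Rightarrow> 'a) set \<Rightarrow> real" where
  "empirical L E = (\<Sum>v\<in>words L X. \<Sum>i<L. indicator E (\<lambda>j. point v (j + int i))) /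
     (real L * real (card (words L X)))"

lemma empirical_nonneg: "0 \<le> empirical L E"
  by (auto simp: empirical_def intro!: divide_nonneg_nonneg sum_nonneg)

lemma empirical_le_1: "empirical L E \<le> 1"
proof -
  have "(\<Sum>v\<in>words L X. \<Sum>i<L. indicator E (\<lambda>j. point v (j + int i))) \<le> (\<Sum>v\<in>words L X. \<Sum>i<L. 1::real)"
    by (intro sum_mono) (auto simp: indicator_def)
  then show ?thesis using card_words_pos[of L]
    by (cases "L = 0") (auto simp: empirical_def divide_le_eq mult.commute)
qed

lemma empirical_space: "0 < L \<Longrightarrow> empirical L X = 1"
  using point(1) translate_in card_words_pos[of L] by (simp add: empirical_def indicator_def)

lemma empirical_Un:
  assumes "E \<inter> F = {}"
  shows "empirical L (E \<union> F) = empirical L E + empirical L F"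
  using assms by (simp add: empirical_def indicator_add[symmetric] sum.distrib add_divide_distrib)

text \<open>The orbit sums telescope: only the times 0 and \<open>L\<close> survive, so invariance
  holds in the limit.\<close>

lemma empirical_shift_vimage:
  "\<bar>empirical L (shift -` E \<inter> X) - empirical L E\<bar> \<le> 1 / real L"
proof (cases "L = 0")
  case False
  let ?f = "\<lambda>v i. indicator E (\<lambda>j. point v (j + int i)) :: real"
  have "(\<Sum>i<L. indicator (shift -` E \<inter> X) (\<lambda>j. point v (j + int i))) - (\<Sum>i<L. ?f v i) = ?f v L - ?f v 0"
    if "v \<in> words L X" for v
  proof -
    have "indicator (shift -` E \<inter> X) (\<lambda>j. point v (j + int i)) = ?f v (Suc i)" for i
    proof -
      have "shift (\<lambda>j. point v (j + int i)) = (\<lambda>j. point v (j + int (Suc i)))"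
        by (simp add: shift_def ac_simps)
      then show ?thesis using translate_in[OF point(1)[OF that]] by (simp add: indicator_def)
    qed
    then show ?thesis
      using sum_lessThan_telescope[of "?f v" L] by (simp only: sum_subtractf[symmetric])
  qed
  then have "empirical L (shift -` E \<inter> X) - empirical L E =
      (\<Sum>v\<in>words L X. ?f v L - ?f v 0) / (real L * real (card (words L X)))"
    by (simp add: empirical_def flip: diff_divide_distrib sum_subtractf)
  also have "\<bar>\<dots>\<bar> \<le> (\<Sum>v\<in>words L X. 1) / (real L * real (card (words L X)))"
    unfolding abs_divide
    by (intro frac_le order_trans[OF sum_abs] sum_mono)
      (auto simp: indicator_def abs_mult zero_less_mult_iff card_words_pos False[unfolded bot_nat_0.not_eq_extremum])
  also have "\<dots> \<le> 1 / real L" using card_words_pos[of L] by simp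
  finally show ?thesis .
qed (simp add: empirical_def)

lemma empirical_cylinder:
  assumes "length w = n"
  shows "empirical L (cylinder X w 0) =
    (\<Sum>i<L. real (card {v \<in> words L X. block (point v) (int i) n = w})) / (real L * real (card (words L X)))"
proof -
  have "indicator (cylinder X w 0) (\<lambda>j. point v (j + int i)) = (if block (point v) (int i) n = w then 1 else 0 :: real)"
    if "v \<in> words L X" for v i
    using translate_in[OF point(1)[OF that]] assms
    by (simp add: cylinder_def block_translate indicator_def)
  then have "(\<Sum>v\<in>words L X. \<Sum>i<L. indicator (cylinder X w 0) (\<lambda>j. point v (j + int i))) =
      (\<Sum>v\<in>words L X. \<Sum>i<L. (if block (point v) (int i) n = w then 1 else 0 :: real))"
    by simp
  also have "\<dots> = (\<Sum>i<L. real (card {v \<in> words L X. block (point v) (int i) n = w}))"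
    by (subst sum.swap) (simp add: sum.If_cases Int_def)
  finally show ?thesis by (simp add: empirical_def)
qed

lemma block_point:
  assumes "v \<in> words L X" "i + n \<le> L"
  shows "block (point v) (int i) n = take n (drop i v)"
  using take_drop_block[of i n L "point v" 0] point(2)[OF assms(1)] assms(2) by simp

end

section \<open>Two-sided bounds for the empirical averages\<close>

context specified_subshift
begin

abbreviation "h \<equiv> topological_entropy X"

text \<open>A word \<open>v\<close> with \<open>w\<close> at position \<open>i\<close> is determined
  by its parts before and after \<open>w\<close>; one factor \<open>K\<close> joins the counts of
  these parts and another bounds the joint count by an exponential. For the last \<open>n\<close>
  positions the trivial bound suffices.\<close>

lemma empirical_cylinder_le:
  assumes w: "w \<in> words n X" and L: "n \<le> L" "0 < L"
  shows "empirical L (cylinder X w 0) \<le> K\<^sup>2 * exp (- real n * h) + real n / real L"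
proof -
  let ?c = "\<lambda>n. real (card (words n X))"
  let ?f = "\<lambda>i. real (card {v \<in> words L X. block (point v) (int i) n = w})"
  have f: "?f i \<le> K\<^sup>2 * exp (- real n * h) * ?c L" if i: "i + n \<le> L" for i
  proof -
    have "card {v \<in> words L X. block (point v) (int i) n = w} \<le> card (words i X \<times> words (L - i - n) X)"
    proof (rule card_inj_on_le[where f = "\<lambda>v. (take i v, drop (i + n) v)"])
      show "inj_on (\<lambda>v. (take i v, drop (i + n) v)) {v \<in> words L X. block (point v) (int i) n = w}"
      proof (rule inj_onI)
        fix u v assume *: "u \<in> {v \<in> words L X. block (point v) (int i) n = w}"
          "v \<in> {v \<in> words L X. block (point v) (int i) n = w}"
          "(take i u, drop (i + n) u) = (take i v, drop (i + n) v)"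
        then have "take n (drop i u) = take n (drop i v)" using i by (auto simp: block_point)
        then show "u = v"
          using * by (metis append_take_drop_id drop_drop add.commute prod.inject)
      qed
      have "i + (n + (L - i - n)) = L" using i by simp
      then show "(\<lambda>v. (take i v, drop (i + n) v)) ` {v \<in> words L X. block (point v) (int i) n = w}
          \<subseteq> words i X \<times> words (L - i - n) X"
        using take_words[of _ i "n + (L - i - n)"] drop_words[of _ "i + n" "L - i - n"]
        by (auto simp: add.assoc)
    qed simp
    then have "?f i \<le> ?c i * ?c (L - i - n)"
      by (simp add: card_cartesian_product flip: of_nat_mult)
    also have "\<dots> \<le> K * ?c (i + (L - i - n))" by (rule card_words_mult_le)
    also have "i + (L - i - n) = L - n" using i by simp
    also have "K * ?c (L - n) \<le> K * (K * exp (real (L - n) * h))"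
      using K_pos by (intro mult_left_mono card_words_le) auto
    also have "\<dots> = K\<^sup>2 * exp (- real n * h) * exp (real L * h)"
      using L by (simp add: power2_eq_square of_nat_diff algebra_simps flip: exp_add)
    also have "\<dots> \<le> K\<^sup>2 * exp (- real n * h) * ?c L"
      by (intro mult_left_mono exp_entropy_le_card_words) auto
    finally show ?thesis .
  qed
  have "(\<Sum>i<L. ?f i) = (\<Sum>i<L - n. ?f i) + (\<Sum>i\<in>{L - n..<L}. ?f i)"
    by (subst sum.union_disjoint[symmetric]) (auto intro!: sum.cong)
  also have "(\<Sum>i<L - n. ?f i) \<le> (\<Sum>i<L - n. K\<^sup>2 * exp (- real n * h) * ?c L)"
    by (intro sum_mono f) auto
  also have "\<dots> \<le> (\<Sum>i<L. K\<^sup>2 * exp (- real n * h) * ?c L)"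
    by (intro sum_mono2) auto
  also have "(\<Sum>i\<in>{L - n..<L}. ?f i) \<le> (\<Sum>i\<in>{L - n..<L}. ?c L)"
    by (intro sum_mono of_nat_mono card_mono) auto
  also have "\<dots> = real n * ?c L" using L by simp
  finally have "(\<Sum>i<L. ?f i) \<le> (K\<^sup>2 * exp (- real n * h) + real n / real L) * (real L * ?c L)"
    using L by (simp add: algebra_simps)
  then show ?thesis
    using L card_words_pos[of L] by (simp add: empirical_cylinder[OF length_words[OF w]] divide_le_eq)
qed

text \<open>The exponential pays for \<open>2 * N\<close> letters of padding. One factor
  \<open>N + 1\<close> is that of the counting lemma, the other counts how often a position is
  reached as \<open>s + j\<close>, and \<open>K\<close> compares the number of words of length
  \<open>L\<close> with \<open>exp (L h)\<close>.\<close>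

definition gibbs :: real where
  "gibbs = exp (- real (2 * N) * h) / (real (N + 1) * real (N + 1) * K)"

lemma gibbs_pos: "0 < gibbs"
  using K_pos by (simp add: gibbs_def)

text \<open>For each \<open>s < r\<close> the remaining length \<open>r\<close> is split into
  \<open>s\<close> letters before \<open>w\<close> and \<open>r - s\<close> after it, and the
  counting lemma gives about \<open>exp (r h)\<close> words with \<open>w\<close> near
  \<open>s\<close>. Summing over \<open>s\<close> hits each position at most \<open>N + 1\<close>
  times.\<close>

lemma empirical_cylinder_ge:
  assumes w: "w \<in> words n X" and L: "L = r + n + 2 * N" "0 < L"
  shows "real r / real L * (gibbs * exp (- real n * h)) \<le> empirical L (cylinder X w 0)"
proof -
  let ?c = "\<lambda>n. real (card (words n X))"
  let ?f = "\<lambda>i. real (card {v \<in> words L X. block (point v) (int i) n = w})"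
  have le: "exp (real r * h) \<le> real (N + 1) * (\<Sum>j\<le>N. ?f (s + j))" if s: "s < r" for s
  proof -
    have "exp (real r * h) = exp (real s * h) * exp (real (r - s) * h)"
      using s by (simp add: of_nat_diff algebra_simps flip: exp_add)
    also have "\<dots> \<le> ?c s * ?c (r - s)"
      by (intro mult_mono exp_entropy_le_card_words) auto
    also have "\<dots> = real (card (words s X) * card (words (r - s) X))" by simp
    also have "\<dots> \<le> real ((N + 1) *
        (\<Sum>j\<le>N. card {z \<in> words (s + n + (r - s) + 2 * N) X. take n (drop (s + j) z) = w}))"
      by (intro of_nat_mono card_words_mult_le_count w)
    also have "s + n + (r - s) + 2 * N = L" using s L by simp
    also have "(\<Sum>j\<le>N. card {z \<in> words L X. take n (drop (s + j) z) = w}) =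
        (\<Sum>j\<le>N. card {v \<in> words L X. block (point v) (int (s + j)) n = w})"
    proof (rule sum.cong[OF refl])
      fix j assume "j \<in> {..N}"
      then have "s + j + n \<le> L" using s L by simp
      then have "{z \<in> words L X. take n (drop (s + j) z) = w} = {v \<in> words L X. block (point v) (int (s + j)) n = w}"
        by (metis block_point)
      then show "card {z \<in> words L X. take n (drop (s + j) z) = w} =
        card {v \<in> words L X. block (point v) (int (s + j)) n = w}" by simp
    qed
    finally show ?thesis by (simp only: of_nat_mult of_nat_sum)
  qed
  have "real r * exp (real r * h) = (\<Sum>s<r. exp (real r * h))" by simp
  also have "\<dots> \<le> (\<Sum>s<r. real (N + 1) * (\<Sum>j\<le>N. ?f (s + j)))"
    by (intro sum_mono le) auto
  also have "\<dots> = real (N + 1) * (\<Sum>j\<le>N. \<Sum>s<r. ?f (s + j))"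
    by (subst sum.swap) (simp only: sum_distrib_left)
  also have "\<dots> \<le> real (N + 1) * (\<Sum>j\<le>N. \<Sum>i<L. ?f i)"
  proof (intro mult_left_mono sum_mono)
    fix j assume "j \<in> {..N}"
    have "(\<Sum>s<r. ?f (s + j)) = (\<Sum>i\<in>(\<lambda>s. s + j) ` {..<r}. ?f i)"
      by (subst sum.reindex) auto
    also have "\<dots> \<le> (\<Sum>i<L. ?f i)"
      using L \<open>j \<in> {..N}\<close> by (intro sum_mono2) auto
    finally show "(\<Sum>s<r. ?f (s + j)) \<le> (\<Sum>i<L. ?f i)" .
  qed auto
  also have "\<dots> = real (N + 1) * real (N + 1) * (\<Sum>i<L. ?f i)" by simp
  finally have sum: "real r * exp (real r * h) \<le> real (N + 1) * real (N + 1) * (\<Sum>i<L. ?f i)" .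
  have "real r / real L * (gibbs * exp (- real n * h)) * (real L * ?c L) =
      real r * (gibbs * exp (- real n * h)) * ?c L" using L by simp
  also have "\<dots> \<le> real r * (gibbs * exp (- real n * h)) * (K * exp (real L * h))"
    using gibbs_pos by (intro mult_left_mono card_words_le) auto
  also have "\<dots> = real r * exp (real r * h) / (real (N + 1) * real (N + 1))"
  proof -
    have "exp (- real (2 * N) * h) * exp (- real n * h) * exp (real L * h) = exp (real r * h)"
      unfolding L by (simp add: algebra_simps flip: exp_add)
    moreover have "real r * (gibbs * exp (- real n * h)) * (K * exp (real L * h)) =
        real r * (exp (- real (2 * N) * h) * exp (- real n * h) * exp (real L * h)) / (real (N + 1) * real (N + 1))"
      using K_pos unfolding gibbs_def by (simp add: field_simps del: of_nat_Suc of_nat_add)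
    ultimately show ?thesis by simp
  qed
  also have "\<dots> \<le> (\<Sum>i<L. ?f i)"
    using sum by (simp add: divide_le_eq mult.commute mult.left_commute)
  finally show ?thesis
    using L(2) card_words_pos[of L] unfolding empirical_cylinder[OF length_words[OF w]]
    by (subst pos_le_divide_eq) auto
qed

end

section \<open>From averages to an invariant measure\<close>

context subshift
begin

lemma space_in_cyl_sets: "X \<in> cyl_sets X"
proof -
  have "X = cyl X 0 0 UNIV" by (simp add: cyl_def)
  then show ?thesis by (metis cyl_in_cyl_sets)
qed

lemma shift_vimage_cyl_sets: "E \<in> cyl_sets X \<Longrightarrow> shift -` E \<inter> X \<in> cyl_sets X"
proof -
  assume "E \<in> cyl_sets X"
  then obtain n l W where "E = cyl X n l W" by (auto simp: cyl_sets_def)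
  then show ?thesis by (simp add: shift_vimage_cyl cyl_in_cyl_sets)
qed

text \<open>By compactness, a decreasing sequence of cylinder sets with empty intersection is
  eventually empty. Any finitely additive set function on them is therefore continuous at the empty
  set, as the Caratheodory extension requires.\<close>

lemma decseq_cyl_sets_empty:
  assumes G: "range E \<subseteq> cyl_sets X" and dec: "decseq E" and empty: "(\<Inter>i. E i) = {}"
  shows "\<forall>\<^sub>F i in sequentially. E i = {}"
proof -
  have clo: "closedin (subtopology (full_shift_topology A) X) (E i)" for i
  proof -
    have "E i \<in> cyl_sets X" using G by auto
    then obtain n l W where "E i = cyl X n l W" by (auto simp: cyl_sets_def)
    then show ?thesis using closedin_cyl by simp
  qed
  obtain i where i: "E i = {}"
    using compact_space_imp_nest[OF compact_subshift clo _ dec] empty by blast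
  have "E j = {}" if "i \<le> j" for j
    using decseqD[OF dec that] i by blast
  then show ?thesis by (auto simp: eventually_sequentially)
qed

text \<open>The measure and its image under the shift agree on an intersection-stable generator,
  hence everywhere.\<close>

lemma invariant_measure_eqI:
  assumes M: "space M = X" "sets M = sigma_sets X (cyl_sets X)" "prob_space M"
    and inv: "\<And>E. E \<in> cyl_sets X \<Longrightarrow> emeasure M (shift -` E \<inter> X) = emeasure M E"
  shows "invariant_measure A X M"
proof -
  interpret prob_space M by (rule M)
  have shift: "shift \<in> measurable M M"
  proof (rule measurable_sigma_sets[where A = "cyl_sets X"])
    show "cyl_sets X \<subseteq> Pow X" by (auto simp: cyl_sets_def cyl_def)
    show "shift -` E \<inter> space M \<in> sets M" if "E \<in> cyl_sets X" for E
      using shift_vimage_cyl_sets[OF that] M by auto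
  qed (use M shift_in in auto)
  have "distr M M shift = M"
  proof (rule measure_eqI_generator_eq[where E = "cyl_sets X" and \<Omega> = X and A = "\<lambda>_. X"])
    show "Int_stable (cyl_sets X)"
      by (rule algebra.Int_stable[OF algebra_cyl_sets])
    show "cyl_sets X \<subseteq> Pow X" by (auto simp: cyl_sets_def cyl_def)
    show "emeasure (distr M M shift) E = emeasure M E" if "E \<in> cyl_sets X" for E
      using inv[OF that] that M shift by (subst emeasure_distr) auto
    show "emeasure (distr M M shift) X \<noteq> \<infinity>"
      using M shift by (subst emeasure_distr) (auto intro: space_in_cyl_sets)
  qed (use M space_in_cyl_sets in auto)
  then have "emeasure M (shift -` E \<inter> space M) = emeasure M E" if "E \<in> sets M" for E
    using emeasure_distr[OF shift that] by simp
  then show ?thesis using M by (simp add: invariant_measure_def sigma_sets_cyl)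
qed

end

context specified_subshift
begin

lemma exists_gibbs_measure:
  obtains M where "invariant_measure A X M"
    "\<And>n w. w \<in> words n X \<Longrightarrow> measure M (cylinder X w 0) \<le> K\<^sup>2 * exp (- real n * h)"
    "\<And>n w. w \<in> words n X \<Longrightarrow> gibbs * exp (- real n * h) \<le> measure M (cylinder X w 0)"
proof -
  let ?G = "cyl_sets X"
  interpret algebra X ?G by (rule algebra_cyl_sets)
  have "\<And>n E. norm (empirical n E) \<le> 1"
    using empirical_nonneg empirical_le_1 by simp
  \<comment> \<open>A diagonal subsequence: the values are bounded and there are only countably many
    cylinder sets.\<close>
  then obtain r where r: "strict_mono (r :: nat \<Rightarrow> nat)"
    "\<And>E. E \<in> ?G \<Longrightarrow> \<exists>l. (\<lambda>k. empirical (r k) E) \<longlonglongrightarrow> l"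
    using function_convergent_subsequence[OF countable_cyl_sets, of empirical 1] by blast
  define f where "f E = lim (\<lambda>k. empirical (r k) E)" for E
  have f: "(\<lambda>k. empirical (r k) E) \<longlonglongrightarrow> f E" if "E \<in> ?G" for E
    using r(2)[OF that] unfolding f_def by (auto simp: limI)
  have r_top: "filterlim r at_top sequentially" using r(1) by (rule filterlim_subseq)
  have r_inf: "filterlim (\<lambda>k. real (r k)) at_infinity sequentially"
    using filterlim_compose[OF filterlim_real_sequentially r_top]
    by (rule filterlim_at_top_imp_at_infinity)
  have r_ge: "\<forall>\<^sub>F k in sequentially. m \<le> r k" for m
    using r_top by (simp add: filterlim_at_top)
  have f_nonneg: "0 \<le> f E" if "E \<in> ?G" for E
    by (rule LIMSEQ_le_const[OF f[OF that]]) (auto simp: empirical_nonneg)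
  have f_space: "f X = 1"
  proof (rule LIMSEQ_unique[OF f[OF space_in_cyl_sets]])
    have "\<forall>\<^sub>F k in sequentially. empirical (r k) X = 1"
      using r_ge[of 1] by eventually_elim (auto intro: empirical_space)
    then show "(\<lambda>k. empirical (r k) X) \<longlonglongrightarrow> 1" by (rule tendsto_eventually)
  qed
  have f_Un: "f (E \<union> F) = f E + f F" if "E \<in> ?G" "F \<in> ?G" "E \<inter> F = {}" for E F
  proof (rule LIMSEQ_unique[OF f])
    show "(\<lambda>k. empirical (r k) (E \<union> F)) \<longlonglongrightarrow> f E + f F"
      using tendsto_add[OF f[OF that(1)] f[OF that(2)]] by (simp add: empirical_Un[OF that(3)])
  qed (use that in auto)
  have f_empty: "f {} = 0" using f_Un[of "{}" "{}"] by simp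
  have f_shift: "f (shift -` E \<inter> X) = f E" if "E \<in> ?G" for E
  proof -
    have "(\<lambda>k. empirical (r k) (shift -` E \<inter> X) - empirical (r k) E) \<longlonglongrightarrow> 0"
    proof (rule Lim_null_comparison)
      show "\<forall>\<^sub>F k in sequentially. norm (empirical (r k) (shift -` E \<inter> X) - empirical (r k) E) \<le> 1 / real (r k)"
        by (simp add: empirical_shift_vimage)
      show "(\<lambda>k. 1 / real (r k)) \<longlonglongrightarrow> 0"
        using r_inf by (rule tendsto_divide_0[OF tendsto_const])
    qed
    moreover have "(\<lambda>k. empirical (r k) (shift -` E \<inter> X) - empirical (r k) E) \<longlonglongrightarrow>
        f (shift -` E \<inter> X) - f E"
      by (intro tendsto_diff f shift_vimage_cyl_sets that)
    ultimately have "f (shift -` E \<inter> X) - f E = 0" by (rule LIMSEQ_unique[THEN sym])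
    then show ?thesis by simp
  qed
  have "\<exists>\<mu>. (\<forall>E\<in>?G. \<mu> E = ennreal (f E)) \<and> measure_space X (sigma_sets X ?G) \<mu>"
  proof (rule caratheodory_empty_continuous)
    show "positive ?G (\<lambda>E. ennreal (f E))" by (simp add: positive_def f_empty)
    show "additive ?G (\<lambda>E. ennreal (f E))"
      by (auto simp: additive_def f_Un f_nonneg ennreal_plus)
    fix E :: "nat \<Rightarrow> (int \<Rightarrow> 'a) set" assume E: "range E \<subseteq> ?G" "decseq E" "(\<Inter>i. E i) = {}"
    have "\<forall>\<^sub>F i in sequentially. ennreal (f (E i)) = 0"
      using decseq_cyl_sets_empty[OF E] by eventually_elim (simp add: f_empty)
    then show "(\<lambda>i. ennreal (f (E i))) \<longlonglongrightarrow> 0" by (rule tendsto_eventually)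
  qed simp
  then obtain \<mu> where \<mu>: "\<And>E. E \<in> ?G \<Longrightarrow> \<mu> E = ennreal (f E)" "measure_space X (sigma_sets X ?G) \<mu>"
    by blast
  define M where "M = measure_of X (sigma_sets X ?G) \<mu>"
  have sub: "?G \<subseteq> Pow X" by (rule space_closed)
  have sigma: "sigma_algebra X (sigma_sets X ?G)" using \<mu>(2) by (simp add: measure_space_def)
  have space: "space M = X" unfolding M_def by (intro space_measure_of) (use sigma_sets_into_sp[OF sub] in auto)
  have sets: "sets M = sigma_sets X ?G"
    unfolding M_def using sigma by (rule sigma_algebra.sets_measure_of_eq)
  have emeasure_M: "emeasure M E = ennreal (f E)" if "E \<in> ?G" for E
    using \<mu> that unfolding M_def
    by (subst emeasure_measure_of_sigma) (auto simp: measure_space_def)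
  have "prob_space M"
    using emeasure_M[OF space_in_cyl_sets] space by (intro prob_spaceI) (simp add: f_space)
  then have "invariant_measure A X M"
    using space sets emeasure_M f_shift shift_vimage_cyl_sets
    by (intro invariant_measure_eqI) auto
  moreover have measure_M: "measure M E = f E" if "E \<in> ?G" for E
    using emeasure_M[OF that] f_nonneg[OF that] by (simp add: measure_def)
  have "measure M (cylinder X w 0) \<le> K\<^sup>2 * exp (- real n * h)" if w: "w \<in> words n X" for n w
  proof -
    have "(\<lambda>k. K\<^sup>2 * exp (- real n * h) + real n / real (r k)) \<longlonglongrightarrow> K\<^sup>2 * exp (- real n * h) + 0"
      using r_inf by (intro tendsto_add tendsto_const tendsto_divide_0[OF tendsto_const])
    moreover have "\<forall>\<^sub>F k in sequentially. empirical (r k) (cylinder X w 0) \<le>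
        K\<^sup>2 * exp (- real n * h) + real n / real (r k)"
      using r_ge[of "Suc n"] by eventually_elim (rule empirical_cylinder_le[OF w], auto)
    ultimately show ?thesis
      using tendsto_le[OF sequentially_bot _ f] by (auto simp: measure_M cylinder_in_cyl_sets)
  qed
  moreover have "gibbs * exp (- real n * h) \<le> measure M (cylinder X w 0)" if w: "w \<in> words n X" for n w
  proof -
    \<comment> \<open>Of the length \<open>r k\<close>, the word and the padding use up
      \<open>?d\<close>; the rest plays the role of \<open>r\<close> in
      \<open>empirical_cylinder_ge\<close>, and its share of \<open>r k\<close> tends to 1.\<close>
    let ?d = "real (n + 2 * N)"
    have "(\<lambda>k. (1 - ?d / real (r k)) * (gibbs * exp (- real n * h))) \<longlonglongrightarrow>
        (1 - 0) * (gibbs * exp (- real n * h))"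
      using r_inf by (intro tendsto_mult tendsto_diff tendsto_const tendsto_divide_0[OF tendsto_const])
    moreover have "\<forall>\<^sub>F k in sequentially. (1 - ?d / real (r k)) * (gibbs * exp (- real n * h)) \<le>
        empirical (r k) (cylinder X w 0)"
      using r_ge[of "Suc (n + 2 * N)"]
    proof eventually_elim
      case (elim k)
      then have "1 - ?d / real (r k) = real (r k - (n + 2 * N)) / real (r k)"
        by (simp add: of_nat_diff field_simps)
      then show ?case
        using empirical_cylinder_ge[OF w, of "r k" "r k - (n + 2 * N)"] elim by simp
    qed
    ultimately show ?thesis
      using tendsto_le[OF sequentially_bot f] by (auto simp: measure_M cylinder_in_cyl_sets)
  qed
  ultimately show thesis using that by blast
qed

end

subsection \<open>Entropy of an invariant measure\<close>

lemma (in subshift) cylinder_words: "w \<in> words l X \<Longrightarrow> cylinder X w n = cyl X n l {w}"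
  using length_words[of w l] by (simp add: cylinder_eq_cyl)

locale invariant_subshift = subshift A X for A :: "'a set" and X +
  fixes M
  assumes inv: "invariant_measure A X M"
begin

lemma space_M: "space M = X" and sets_M: "sets M = sigma_sets X (cyl_sets X)"
  and prob_space_M: "prob_space M"
  and emeasure_shift: "E \<in> sets M \<Longrightarrow> emeasure M (shift -` E \<inter> X) = emeasure M E"
  using inv by (auto simp: invariant_measure_def sigma_sets_cyl)

sublocale prob_space M by (rule prob_space_M)

lemma measure_shift: "E \<in> sets M \<Longrightarrow> measure M (shift -` E \<inter> X) = measure M E"
  by (simp add: measure_def emeasure_shift)

lemma cyl_sets_in_sets: "E \<in> cyl_sets X \<Longrightarrow> E \<in> sets M"
  by (auto simp: sets_M)

lemma cyl_measurable [measurable, simp]: "cyl X n l W \<in> sets M"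
  by (intro cyl_sets_in_sets) auto

lemma cylinder_measurable [measurable, simp]: "cylinder X w n \<in> sets M"
  by (simp add: cylinder_eq_cyl)

lemma shift_measurable: "shift \<in> measurable M M"
proof (rule measurable_sigma_sets[OF sets_M])
  show "cyl_sets X \<subseteq> Pow X" by (auto simp: cyl_sets_def cyl_def)
  show "shift -` E \<inter> space M \<in> sets M" if "E \<in> cyl_sets X" for E
    using shift_vimage_cyl_sets[OF that] by (simp add: space_M cyl_sets_in_sets)
qed (simp add: space_M shift_in)

lemma measure_cyl_position: "measure M (cyl X n l W) = measure M (cyl X 0 l W)"
proof (induction n rule: int_induct[where k = 0])
  case (step1 n)
  then show ?case using measure_shift[of "cyl X n l W"] by (simp add: shift_vimage_cyl)
next
  case (step2 n)
  then show ?case using measure_shift[of "cyl X (n - 1) l W"] by (simp add: shift_vimage_cyl)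
qed simp

abbreviation P :: "'a list \<Rightarrow> real" where
  "P w \<equiv> measure M (cylinder X w 0)"

lemma measure_cylinder_position: "measure M (cylinder X w n) = P w"
  by (simp only: cylinder_eq_cyl measure_cyl_position[of n])

lemma measure_cyl: "measure M (cyl X n l W) = (\<Sum>w\<in>words l X \<inter> W. P w)"
proof -
  have "cyl X n l W = (\<Union>w\<in>words l X \<inter> W. cyl X n l {w})"
    by (auto simp: cyl_def)
  also have "measure M \<dots> = (\<Sum>w\<in>words l X \<inter> W. measure M (cyl X n l {w}))"
  proof (intro finite_measure_finite_Union)
    show "disjoint_family_on (\<lambda>w. cyl X n l {w}) (words l X \<inter> W)"
      by (auto simp: disjoint_family_on_def cyl_def)
  qed auto
  also have "\<dots> = (\<Sum>w\<in>words l X \<inter> W. P w)"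
    by (intro sum.cong refl) (simp add: cylinder_words[of _ l] measure_cyl_position[of n])
  finally show ?thesis .
qed

lemma sum_P: "(\<Sum>w\<in>words n X. P w) = 1"
proof -
  have "cyl X 0 n UNIV = space M" by (simp add: cyl_def space_M)
  then have "measure M (cyl X 0 n UNIV) = 1" by (simp only: prob_space)
  then show ?thesis by (simp only: measure_cyl Int_UNIV_right)
qed

text \<open>Consistency of the block distributions, stated for averages of \<open>g\<close> because
  it is applied to the logarithm of \<open>P\<close>.\<close>

lemma sum_P_take:
  "(\<Sum>w\<in>words (m + n) X. P w * g (take m w)) = (\<Sum>u\<in>words m X. P u * g u)"
proof -
  have "P u = (\<Sum>w\<in>{w \<in> words (m + n) X. take m w = u}. P w)" if u: "u \<in> words m X" for u
  proof -
    have "cylinder X u 0 = cyl X 0 (m + n) {w. take m w = u}"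
      using length_words[OF u] by (auto simp: cylinder_def cyl_def block_add)
    then show ?thesis by (simp add: measure_cyl Int_def)
  qed
  then have "(\<Sum>u\<in>words m X. P u * g u) =
      (\<Sum>u\<in>words m X. \<Sum>w\<in>{w \<in> words (m + n) X. take m w = u}. P w * g (take m w))"
    by (simp add: sum_distrib_right)
  then show ?thesis
    by (subst (asm) sum.group) (auto intro: take_words)
qed

text \<open>Unlike for prefixes, shift invariance enters here: the suffix is read at position
  \<open>m\<close> and has to be moved to 0.\<close>

lemma sum_P_drop:
  "(\<Sum>w\<in>words (m + n) X. P w * g (drop m w)) = (\<Sum>v\<in>words n X. P v * g v)"
proof -
  have "P v = (\<Sum>w\<in>{w \<in> words (m + n) X. drop m w = v}. P w)" if v: "v \<in> words n X" for v
  proof -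
    have "cylinder X v (int m) = cyl X 0 (m + n) {w. drop m w = v}"
      using length_words[OF v] by (auto simp: cylinder_def cyl_def block_add)
    then show ?thesis using measure_cylinder_position[of v "int m"] by (simp add: measure_cyl Int_def)
  qed
  then have "(\<Sum>v\<in>words n X. P v * g v) =
      (\<Sum>v\<in>words n X. \<Sum>w\<in>{w \<in> words (m + n) X. drop m w = v}. P w * g (drop m w))"
    by (simp add: sum_distrib_right)
  then show ?thesis
    by (subst (asm) sum.group) (auto intro: drop_words)
qed

definition block_entropy :: "nat \<Rightarrow> real" where
  "block_entropy n = - (\<Sum>w\<in>words n X. P w * ln (P w))"

lemma block_entropy_le:
  assumes "\<And>w. w \<in> words n X \<Longrightarrow> 0 \<le> q w" "sum q (words n X) \<le> 1"
    and "\<And>w. w \<in> words n X \<Longrightarrow> q w = 0 \<Longrightarrow> P w = 0"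
  shows "block_entropy n \<le> - (\<Sum>w\<in>words n X. P w * ln (q w))"
  unfolding block_entropy_def using assms
  by (intro sum_neg_mult_ln_le) (auto simp: sum_P)

lemma block_entropy_nonneg: "0 \<le> block_entropy n"
proof -
  have "P w * ln (P w) \<le> 0" for w
    by (cases "P w = 0") (auto intro!: mult_nonneg_nonpos simp: zero_less_measure_iff)
  then show ?thesis by (simp add: block_entropy_def sum_nonpos)
qed

text \<open>Gibbs' inequality against the product of the two marginals. Their product weight sums to
  at most 1, as the words of length \<open>m + n\<close> embed into the pairs of words.\<close>

lemma block_entropy_add_le: "block_entropy (m + n) \<le> block_entropy m + block_entropy n"
proof -
  define q where "q w = P (take m w) * P (drop m w)" for w
  have zero: "P w = 0" if w: "w \<in> words (m + n) X" and q: "q w = 0" for w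
  proof -
    have len: "length w = m + n" by (rule length_words[OF w])
    have "cylinder X w 0 \<subseteq> cylinder X (take m w) 0" "cylinder X w 0 \<subseteq> cylinder X (drop m w) (int m)"
    proof -
      have "block x 0 m = take m w \<and> block x (int m) n = drop m w" if "block x 0 (m + n) = w" for x
        using that by (auto simp: block_add)
      then show "cylinder X w 0 \<subseteq> cylinder X (take m w) 0"
        "cylinder X w 0 \<subseteq> cylinder X (drop m w) (int m)"
        using len by (auto simp: cylinder_def)
    qed
    then have "P w \<le> P (take m w)" "P w \<le> measure M (cylinder X (drop m w) (int m))"
      by (auto intro!: finite_measure_mono)
    moreover have "P (take m w) = 0 \<or> P (drop m w) = 0" using q by (simp add: q_def)
    ultimately show ?thesis
      using measure_nonneg[of M "cylinder X w 0"] measure_cylinder_position[of "drop m w" "int m"]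
      by linarith
  qed
  have "sum q (words (m + n) X) = (\<Sum>p\<in>(\<lambda>w. (take m w, drop m w)) ` words (m + n) X. P (fst p) * P (snd p))"
  proof (subst sum.reindex)
    show "inj_on (\<lambda>w. (take m w, drop m w)) (words (m + n) X)"
      by (rule inj_onI) (metis append_take_drop_id prod.inject)
  qed (simp add: q_def)
  also have "\<dots> \<le> (\<Sum>p\<in>words m X \<times> words n X. P (fst p) * P (snd p))"
    by (intro sum_mono2) (auto intro: take_words drop_words)
  also have "\<dots> = (\<Sum>u\<in>words m X. P u) * (\<Sum>v\<in>words n X. P v)"
    unfolding sum_product sum.cartesian_product by (simp add: case_prod_beta)
  finally have "sum q (words (m + n) X) \<le> 1" by (simp add: sum_P)
  then have "block_entropy (m + n) \<le> - (\<Sum>w\<in>words (m + n) X. P w * ln (q w))"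
    using zero by (intro block_entropy_le) (auto simp: q_def)
  also have "(\<Sum>w\<in>words (m + n) X. P w * ln (q w)) =
      (\<Sum>w\<in>words (m + n) X. P w * ln (P (take m w)) + P w * ln (P (drop m w)))"
  proof (rule sum.cong[OF refl])
    fix w assume w: "w \<in> words (m + n) X"
    show "P w * ln (q w) = P w * ln (P (take m w)) + P w * ln (P (drop m w))"
    proof (cases "P w = 0")
      case False
      then have "q w \<noteq> 0" using zero[OF w] by blast
      then show ?thesis by (simp add: q_def ln_mult algebra_simps)
    qed simp
  qed
  finally show ?thesis
    using sum_P_take[where g = "\<lambda>u. ln (P u)"] sum_P_drop[where g = "\<lambda>u. ln (P u)"]
    by (simp add: sum.distrib block_entropy_def)
qed

text \<open>Makes the \<open>lim\<close> in \<open>measure_entropy\<close> a true limit; the outer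
  minus sign there cancels the one in \<open>block_entropy\<close>.\<close>

lemma measure_entropy_limit: "(\<lambda>n. block_entropy n / real n) \<longlonglongrightarrow> measure_entropy X M"
proof -
  have "convergent (\<lambda>n. block_entropy n / real n)"
    by (intro subadditive_convergent block_entropy_add_le block_entropy_nonneg)
  then obtain l where l: "(\<lambda>n. block_entropy n / real n) \<longlonglongrightarrow> l" by (auto simp: convergent_def)
  then have "(\<lambda>n. - (block_entropy n / real n)) \<longlonglongrightarrow> - l" by (rule tendsto_minus)
  then have "lim (\<lambda>n. - (block_entropy n / real n)) = - l" by (rule limI)
  then have "measure_entropy X M = l" by (simp add: measure_entropy_def block_entropy_def)
  with l show ?thesis by simp
qed

lemma measure_entropy_le: "real n * measure_entropy X M \<le> block_entropy n"
  by (rule subadditive_limit_le[OF block_entropy_add_le measure_entropy_limit])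

lemma block_entropy_le_ln_card: "block_entropy n \<le> ln (real (card (words n X)))"
proof -
  have "block_entropy n \<le> - (\<Sum>w\<in>words n X. P w * ln (1 / real (card (words n X))))"
    by (intro block_entropy_le) auto
  also have "\<dots> = ln (real (card (words n X))) * (\<Sum>w\<in>words n X. P w)"
    using card_words_pos[of n] by (simp add: ln_div sum_negf sum_distrib_left mult.commute)
  finally show ?thesis by (simp add: sum_P)
qed

end

subsection \<open>Uniqueness\<close>

locale gibbs_subshift = specified_subshift A X N + invariant_subshift A X M
  for A :: "'a set" and X N M +
  assumes P_le: "\<And>n w. w \<in> words n X \<Longrightarrow> measure M (cylinder X w 0) \<le> K\<^sup>2 * exp (- real n * h)"
    and P_ge: "\<And>n w. w \<in> words n X \<Longrightarrow> gibbs * exp (- real n * h) \<le> measure M (cylinder X w 0)"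
begin

lemma block_entropy_ge: "real n * h - ln (K\<^sup>2) \<le> block_entropy n"
proof -
  have "P w * ln (P w) \<le> P w * (ln (K\<^sup>2) - real n * h)" if w: "w \<in> words n X" for w
  proof (cases "P w = 0")
    case False
    then have "ln (P w) \<le> ln (K\<^sup>2 * exp (- real n * h))"
      using P_le[OF w] K_pos by (subst ln_le_cancel_iff) (auto simp: zero_less_measure_iff)
    also have "\<dots> = ln (K\<^sup>2) - real n * h" using K_pos by (subst ln_mult) auto
    finally show ?thesis by (intro mult_left_mono) auto
  qed simp
  then have "(\<Sum>w\<in>words n X. P w * ln (P w)) \<le> (\<Sum>w\<in>words n X. P w) * (ln (K\<^sup>2) - real n * h)"
    unfolding sum_distrib_right by (rule sum_mono)
  then show ?thesis by (simp add: sum_P block_entropy_def)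
qed

lemma maximal_entropy: "measure_of_maximal_entropy A X M"
proof -
  have "(\<lambda>n. block_entropy n / real n) \<longlonglongrightarrow> h"
  proof (rule tendsto_sandwich[OF _ _ _ topological_entropy_limit])
    have "(\<lambda>n. h - ln (K\<^sup>2) / real n) \<longlonglongrightarrow> h - 0"
      by (intro tendsto_diff tendsto_const lim_const_over_n)
    then show "(\<lambda>n. h - ln (K\<^sup>2) / real n) \<longlonglongrightarrow> h" by simp
    show "\<forall>\<^sub>F n in sequentially. h - ln (K\<^sup>2) / real n \<le> block_entropy n / real n"
      using eventually_gt_at_top[of 0]
    proof eventually_elim
      case (elim n)
      then have "h - ln (K\<^sup>2) / real n = (real n * h - ln (K\<^sup>2)) / real n" by (simp add: field_simps)
      also have "\<dots> \<le> block_entropy n / real n" by (intro divide_right_mono block_entropy_ge) auto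
      finally show ?case .
    qed
    show "\<forall>\<^sub>F n in sequentially. block_entropy n / real n \<le> ln (real (card (words n X))) / real n"
      by (intro always_eventually allI divide_right_mono block_entropy_le_ln_card) auto
  qed
  then have "measure_entropy X M = h" using measure_entropy_limit LIMSEQ_unique by blast
  then show ?thesis using inv by (simp add: measure_of_maximal_entropy_def)
qed

text \<open>\<open>gibbs\<close> comes from the lower bound for a glued word, the exponential from
  its gap of length at most \<open>N\<close>, and \<open>K ^ 4\<close> from the upper bounds for the
  two words that are glued.\<close>

definition mixing :: real where
  "mixing = gibbs * exp (- real N * h) / K ^ 4"

lemma mixing_pos: "0 < mixing"
  using gibbs_pos K_pos by (simp add: mixing_def)

text \<open>Ensures that the longest gap is the worst one in
  \<open>cylinders_mixing\<close>.\<close>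

lemma entropy_nonneg: "0 \<le> h"
proof (rule LIMSEQ_le_const[OF topological_entropy_limit], intro exI allI impI)
  show "0 \<le> ln (real (card (words n X))) / real n" for n
    using card_words_pos[of n] by (intro divide_nonneg_nonneg ln_ge_zero) auto
qed

text \<open>The cylinder of a glued word lies in one of the intersections. Which one depends on
  \<open>u\<close> and \<open>v\<close>; the sum over all gap lengths removes this
  dependence.\<close>

lemma cylinders_mixing:
  assumes u: "u \<in> words l X" and v: "v \<in> words l X"
  shows "mixing * (P u * P v) \<le>
    (\<Sum>j\<le>N. measure M (cylinder X u n \<inter> cylinder X v (n + int (l + j))))"
proof -
  obtain w where w: "length w \<le> N" "u @ w @ v \<in> words (l + length w + l) X"
    using glue[OF u v] by blast
  have "P u * P v \<le> (K\<^sup>2 * exp (- real l * h)) * (K\<^sup>2 * exp (- real l * h))"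
    using P_le[OF u] P_le[OF v] by (intro mult_mono) auto
  also have "\<dots> = K ^ 4 * exp (- real (2 * l) * h)"
    by (simp add: power2_eq_square power4_eq_xxxx algebra_simps flip: exp_add)
  finally have "mixing * (P u * P v) \<le> mixing * (K ^ 4 * exp (- real (2 * l) * h))"
    using mixing_pos by (intro mult_left_mono) auto
  also have "\<dots> = gibbs * (exp (- real N * h) * exp (- real (2 * l) * h))"
    using K_pos by (simp add: mixing_def)
  also have "\<dots> \<le> gibbs * exp (- real (l + length w + l) * h)"
  proof (rule mult_left_mono)
    have "real (length w) * h \<le> real N * h" using w entropy_nonneg by (intro mult_right_mono) auto
    then show "exp (- real N * h) * exp (- real (2 * l) * h) \<le> exp (- real (l + length w + l) * h)"
      by (simp add: algebra_simps flip: exp_add)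
  qed (use gibbs_pos in auto)
  also have "\<dots> \<le> P (u @ w @ v)" by (rule P_ge[OF w(2)])
  also have "\<dots> = measure M (cylinder X (u @ w @ v) n)" by (rule measure_cylinder_position[symmetric])
  also have "\<dots> \<le> measure M (cylinder X u n \<inter> cylinder X v (n + int (l + length w)))"
  proof (rule finite_measure_mono)
    show "cylinder X (u @ w @ v) n \<subseteq> cylinder X u n \<inter> cylinder X v (n + int (l + length w))"
      by (auto simp: cylinder_def block_add length_words[OF u] length_words[OF v] add.assoc)
  qed (intro sets.Int cylinder_measurable)
  also have "\<dots> \<le> (\<Sum>j\<le>N. measure M (cylinder X u n \<inter> cylinder X v (n + int (l + j))))"
    using w by (intro member_le_sum[where i = "length w"]) auto
  finally show ?thesis .
qed

text \<open>Both sides are sums over pairs of words, and \<open>mixing\<close> depends neither on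
  the pair nor on \<open>l\<close>, so the bounds for single cylinders add up.\<close>

lemma cyl_mixing:
  "mixing * (measure M (cyl X n l W) * measure M (cyl X n l V)) \<le>
    (\<Sum>j\<le>N. measure M (cyl X n l W \<inter> cyl X (n + int (l + j)) l V))"
proof -
  let ?W = "words l X \<inter> W" and ?V = "words l X \<inter> V"
  have split: "measure M (cyl X n l W \<inter> cyl X m l V) =
      (\<Sum>(u, v)\<in>?W \<times> ?V. measure M (cylinder X u n \<inter> cylinder X v m))" for m
  proof -
    have "cyl X n l W \<inter> cyl X m l V = (\<Union>p\<in>?W \<times> ?V. cyl X n l {fst p} \<inter> cyl X m l {snd p})"
      by (auto simp: cyl_def)
    also have "measure M \<dots> = (\<Sum>p\<in>?W \<times> ?V. measure M (cyl X n l {fst p} \<inter> cyl X m l {snd p}))"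
    proof (intro finite_measure_finite_Union)
      show "disjoint_family_on (\<lambda>p. cyl X n l {fst p} \<inter> cyl X m l {snd p}) (?W \<times> ?V)"
        by (auto simp: disjoint_family_on_def cyl_def)
    qed auto
    also have "\<dots> = (\<Sum>(u, v)\<in>?W \<times> ?V. measure M (cylinder X u n \<inter> cylinder X v m))"
      by (intro sum.cong refl) (auto simp: cylinder_words[of _ l])
    finally show ?thesis .
  qed
  have "measure M (cyl X n l W) * measure M (cyl X n l V) = (\<Sum>(u, v)\<in>?W \<times> ?V. P u * P v)"
    unfolding measure_cyl sum_product sum.cartesian_product ..
  then have "mixing * (measure M (cyl X n l W) * measure M (cyl X n l V)) =
      (\<Sum>(u, v)\<in>?W \<times> ?V. mixing * (P u * P v))"
    by (simp add: sum_distrib_left case_prod_beta)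
  also have "\<dots> \<le> (\<Sum>(u, v)\<in>?W \<times> ?V. \<Sum>j\<le>N. measure M (cylinder X u n \<inter> cylinder X v (n + int (l + j))))"
    by (intro sum_mono) (auto intro!: cylinders_mixing simp del: of_nat_add)
  also have "\<dots> = (\<Sum>j\<le>N. measure M (cyl X n l W \<inter> cyl X (n + int (l + j)) l V))"
    unfolding split case_prod_beta by (rule sum.swap)
  finally show ?thesis .
qed

end

section \<open>Ergodicity\<close>

context invariant_subshift
begin

abbreviation pull :: "nat \<Rightarrow> (int \<Rightarrow> 'a) set \<Rightarrow> (int \<Rightarrow> 'a) set" where
  "pull k E \<equiv> (shift ^^ k) -` E \<inter> X"

lemma shift_pow_measurable: "shift ^^ k \<in> measurable M M"
proof (induction k)
  case (Suc k)
  then show ?case using shift_measurable by (simp add: measurable_comp)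
qed (simp add: id_def)

lemma pull_measurable: "E \<in> sets M \<Longrightarrow> pull k E \<in> sets M"
  using measurable_sets[OF shift_pow_measurable] by (simp add: space_M)

lemma pull_Suc: "pull (Suc k) E = shift -` pull k E \<inter> X"
  by (auto simp: funpow_Suc_right shift_in simp del: funpow.simps)

lemma measure_pull: "E \<in> sets M \<Longrightarrow> measure M (pull k E) = measure M E"
proof (induction k)
  case 0
  then have "E \<subseteq> X" using sets.sets_into_space space_M by blast
  then show ?case by (simp add: Int_absorb2)
next
  case (Suc k)
  then show ?case
    unfolding pull_Suc using measure_shift[OF pull_measurable[OF Suc.prems], of k] by (simp only:)
qed

lemma pull_cyl: "pull k (cyl X n l W) = cyl X (n + int k) l W"
proof (induction k)
  case 0
  show ?case by (auto simp: cyl_def)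
next
  case (Suc k)
  then show ?case unfolding pull_Suc Suc by (simp add: shift_vimage_cyl algebra_simps)
qed

text \<open>A point of \<open>E\<close> outside \<open>pull (Suc k) E\<close> either leaves
  \<open>E\<close> at the first step or is mapped into \<open>E - pull k E\<close>, which is null by
  induction.\<close>

lemma measure_diff_pull:
  assumes E: "E \<in> sets M" and "measure M (sym_diff E (shift -` E \<inter> X)) = 0"
  shows "measure M (E - pull k E) = 0"
proof (induction k)
  case 0
  have "E \<subseteq> X" using E sets.sets_into_space space_M by blast
  then have "E - pull 0 E = {}" by auto
  then show ?case by (simp only: measure_empty)
next
  case (Suc k)
  have S: "shift -` F \<inter> X \<in> sets M" if "F \<in> sets M" for F
    using measurable_sets[OF shift_measurable that] by (simp add: space_M)
  have "E - pull (Suc k) E \<subseteq> sym_diff E (shift -` E \<inter> X) \<union> (shift -` (E - pull k E) \<inter> X)"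
    unfolding pull_Suc by auto
  then have "measure M (E - pull (Suc k) E) \<le>
      measure M (sym_diff E (shift -` E \<inter> X) \<union> (shift -` (E - pull k E) \<inter> X))"
    using E S pull_measurable[OF E] by (intro finite_measure_mono) auto
  also have "\<dots> \<le> measure M (sym_diff E (shift -` E \<inter> X)) + measure M (shift -` (E - pull k E) \<inter> X)"
    using E S pull_measurable[OF E] by (intro measure_Un_le) auto
  also have "measure M (shift -` (E - pull k E) \<inter> X) = measure M (E - pull k E)"
    using E pull_measurable[OF E] by (intro measure_shift) auto
  finally show ?case using assms Suc measure_nonneg[of M "E - pull (Suc k) E"] by linarith
qed

end

context gibbs_subshift
begin

text \<open>If a clopen \<open>D\<close> of mass \<open>d\<close> is close to \<open>E\<close>, then
  \<open>D\<close> meets every pullback of its complement in mass at most \<open>2 * e\<close>,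
  while \<open>cyl_mixing\<close> bounds the sum of \<open>N + 1\<close> such masses below by a
  multiple of \<open>d * (1 - d)\<close>. Uniformity in the time \<open>k\<close> is essential: the
  times involved start at the window length of \<open>D\<close>, over which there is no control as
  \<open>e\<close> decreases.\<close>

lemma ergodic:
  assumes E: "E \<in> sets M" and inv_E: "measure M (sym_diff E (shift -` E \<inter> X)) = 0"
  shows "measure M E = 0 \<or> measure M E = 1"
proof -
  define a where "a = measure M E"
  have bound: "mixing * (a * (1 - a)) \<le> (2 * real (N + 1) + mixing) * e" if e: "0 < e" for e
  proof -
    have "finite_measure M" by (rule finite_measureI) (simp add: emeasure_space_1)
    then obtain D where D: "D \<in> cyl_sets X" "measure M (sym_diff E D) < e"
      using sigma_sets_approximation[OF algebra_cyl_sets _ sets_M _ sets_M _ e] E sets_M by blast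
    then obtain n l W where DW: "D = cyl X n l W" by (auto simp: cyl_sets_def)
    have [measurable]: "D \<in> sets M" "E \<in> sets M" using D E cyl_sets_in_sets by auto
    define V where "V = cyl X n l (- W)"
    have V: "V = X - D" by (simp add: V_def DW cyl_Compl)
    have EX: "E \<subseteq> X" using E sets.sets_into_space space_M by blast
    have diffs: "measure M (D - E) < e" "measure M (E - D) < e"
      using finite_measure_mono[of "D - E" "sym_diff E D"] finite_measure_mono[of "E - D" "sym_diff E D"] D(2)
      by auto
    have DV: "measure M (D \<inter> pull k V) \<le> 2 * e" for k
    proof -
      have "D \<inter> pull k V \<subseteq> (D - E) \<union> (pull k (E - D) \<union> (E - pull k E))"
        by (auto simp: V)
      then have "measure M (D \<inter> pull k V) \<le> measure M ((D - E) \<union> (pull k (E - D) \<union> (E - pull k E)))"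
        using pull_measurable E D by (intro finite_measure_mono) auto
      also have "\<dots> \<le> measure M (D - E) + (measure M (pull k (E - D)) + measure M (E - pull k E))"
        using pull_measurable E D
        by (intro order_trans[OF measure_Un_le] add_left_mono measure_Un_le) auto
      also have "measure M (pull k (E - D)) = measure M (E - D)" by (intro measure_pull) auto
      finally show ?thesis using diffs measure_diff_pull[OF E inv_E, of k] by linarith
    qed
    define d where "d = measure M D"
    have d: "measure M V = 1 - d"
      using prob_compl[of D] by (simp add: V d_def space_M)
    have "\<bar>a - d\<bar> < e"
      using finite_measure_Diff'[of E D] finite_measure_Diff'[of D E] diffs
        measure_nonneg[of M "E - D"] measure_nonneg[of M "D - E"]
      by (auto simp: a_def d_def Int_commute abs_less_iff)
    moreover have "0 \<le> a" "a \<le> 1" "0 \<le> d" "d \<le> 1" by (auto simp: a_def d_def)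
    \<comment> \<open>The function \<open>t * (1 - t)\<close> is 1-Lipschitz on the unit
      interval.\<close>
    ultimately have "a * (1 - a) - d * (1 - d) \<le> e"
    proof -
      have "a * (1 - a) - d * (1 - d) = (a - d) * (1 - (a + d))" by (simp add: algebra_simps)
      also have "\<dots> \<le> \<bar>a - d\<bar> * \<bar>1 - (a + d)\<bar>" by (simp flip: abs_mult)
      also have "\<dots> \<le> \<bar>a - d\<bar> * 1"
        using \<open>0 \<le> a\<close> \<open>a \<le> 1\<close> \<open>0 \<le> d\<close> \<open>d \<le> 1\<close> by (intro mult_left_mono) auto
      finally show ?thesis using \<open>\<bar>a - d\<bar> < e\<close> by simp
    qed
    then have "mixing * (a * (1 - a)) \<le> mixing * (d * (1 - d)) + mixing * e"
      using mixing_pos by (simp flip: distrib_left)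
    also have "mixing * (d * (1 - d)) \<le> (\<Sum>j\<le>N. measure M (D \<inter> pull (l + j) V))"
      using cyl_mixing[of n l W "- W"]
      unfolding pull_cyl[symmetric] V_def[symmetric] DW[symmetric] d d_def[symmetric] .
    also have "\<dots> \<le> (\<Sum>j\<le>N. 2 * e)" by (intro sum_mono DV)
    finally show ?thesis by (simp add: algebra_simps)
  qed
  define t where "t = mixing * (a * (1 - a))"
  define c where "c = 2 * real (N + 1) + mixing"
  have c: "0 < c" using mixing_pos by (simp add: c_def)
  have "t \<le> 0"
  proof (rule ccontr)
    assume "\<not> t \<le> 0"
    then have pos: "0 < t" by simp
    then have "t \<le> c * (t / (2 * c))"
      using bound[of "t / (2 * c)", folded t_def c_def] c by simp
    also have "\<dots> = t / 2" using c by simp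
    finally show False using pos by simp
  qed
  then have "a * (1 - a) \<le> 0" using mixing_pos by (simp add: t_def mult_le_0_iff)
  then have "a \<le> 0 \<or> 1 \<le> a" by (auto simp: mult_le_0_iff)
  then show ?thesis
    using measure_nonneg[of M E] prob_le_1[of E] unfolding a_def by linarith
qed

section \<open>Absolute continuity of every measure of maximal entropy\<close>

definition bowen :: real where
  "bowen = ln 2 + \<bar>ln gibbs\<bar> + \<bar>ln K\<bar>"

lemma bowen_pos: "0 < bowen"
  by (simp add: bowen_def add_pos_nonneg)

text \<open>Concentration of \<open>Q\<close> on few words of length \<open>l\<close> lowers its
  block entropy, which maximality keeps at \<open>l h\<close> or more. The lower bound
  \<open>P_ge\<close> turns the number of words in \<open>D\<close> into mass under
  \<open>M\<close>: there are at most \<open>m * exp (l h) / gibbs\<close> of them.\<close>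

lemma maximal_entropy_cyl_bound:
  assumes Q: "measure_of_maximal_entropy A X Q" and pos: "0 < measure Q (cyl X n l W)"
  shows "0 < measure M (cyl X n l W)"
    and "- measure Q (cyl X n l W) * ln (measure M (cyl X n l W)) \<le> bowen"
proof -
  interpret Q: invariant_subshift A X Q
    using Q by unfold_locales (simp add: measure_of_maximal_entropy_def)
  define q where "q = measure Q (cyl X n l W)"
  define m where "m = measure M (cyl X n l W)"
  define D where "D = words l X \<inter> W"
  define d where "d = real (card D)"
  define c where "c = real (card (words l X))"
  have abs_le: "t * y \<le> \<bar>y\<bar>" if "0 \<le> t" "t \<le> 1" for t y :: real
    using mult_left_mono[OF abs_ge_self[of y] that(1)] mult_right_mono[OF that(2) abs_ge_zero[of y]]
    by simp
  have finD: "finite D" by (simp add: D_def)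
  have q_sum: "q = (\<Sum>w\<in>D. Q.P w)" unfolding q_def D_def by (rule Q.measure_cyl)
  have q1: "0 < q" "q \<le> 1" using pos by (auto simp: q_def)
  have "D \<noteq> {}" using q1 q_sum by auto
  then have d: "0 < d" using finD by (simp add: d_def card_gt_0_iff)
  have c: "0 < c" using card_words_pos by (simp add: c_def)
  have "d * (gibbs * exp (- real l * h)) = (\<Sum>w\<in>D. gibbs * exp (- real l * h))"
    by (simp add: d_def)
  also have "\<dots> \<le> (\<Sum>w\<in>D. P w)" by (intro sum_mono P_ge) (auto simp: D_def)
  also have "\<dots> = m" unfolding m_def D_def by (rule measure_cyl[symmetric])
  finally have dm: "d * (gibbs * exp (- real l * h)) \<le> m" .
  then show m: "0 < measure M (cyl X n l W)"
    using d gibbs_pos unfolding m_def[symmetric] by (smt (verit) exp_gt_zero mult_pos_pos)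
  have split: "sum g (words l X) = sum g (words l X - D) + sum g D" for g :: "'a list \<Rightarrow> real"
    by (rule sum.subset_diff) (auto simp: D_def)
  \<comment> \<open>Comparison with this weight bounds the entropy by \<open>q ln (2 d) + (1 - q) ln (2 c)\<close>.\<close>
  define p where "p w = (if w \<in> D then 1 / (2 * d) else 1 / (2 * c))" for w
  have "sum p (words l X) = sum p D + sum p (words l X - D)"
    by (simp only: split add.commute)
  also have "sum p D = 1 / 2" using d by (simp add: p_def d_def)
  also have "sum p (words l X - D) = (\<Sum>w\<in>words l X - D. 1 / (2 * c))"
    by (intro sum.cong) (auto simp: p_def)
  also have "\<dots> \<le> (\<Sum>w\<in>words l X. 1 / (2 * c))" using c by (intro sum_mono2) auto
  also have "\<dots> = 1 / 2" using c by (simp add: c_def)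
  finally have "sum p (words l X) \<le> 1" by simp
  then have "Q.block_entropy l \<le> - (\<Sum>w\<in>words l X. Q.P w * ln (p w))"
    using c d by (intro Q.block_entropy_le) (auto simp: p_def split: if_splits)
  also have "(\<Sum>w\<in>words l X. Q.P w * ln (p w)) =
      (\<Sum>w\<in>D. Q.P w * ln (p w)) + (\<Sum>w\<in>words l X - D. Q.P w * ln (p w))"
    by (simp only: split add.commute)
  also have "(\<Sum>w\<in>D. Q.P w * ln (p w)) = q * ln (1 / (2 * d))"
    by (simp add: q_sum p_def sum_distrib_right)
  also have "(\<Sum>w\<in>words l X - D. Q.P w * ln (p w)) = (\<Sum>w\<in>words l X - D. Q.P w * ln (1 / (2 * c)))"
    by (intro sum.cong) (auto simp: p_def)
  also have "\<dots> = (1 - q) * ln (1 / (2 * c))"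
    using Q.sum_P[of l] split[of Q.P] by (simp add: q_sum flip: sum_distrib_right)
  finally have upper: "Q.block_entropy l \<le> q * ln (2 * d) + (1 - q) * ln (2 * c)"
    using c d by (simp add: ln_div)
  have "real l * h \<le> Q.block_entropy l"
    using Q.measure_entropy_le[of l] Q by (simp add: measure_of_maximal_entropy_def)
  also note upper
  also have "ln (2 * d) \<le> ln 2 + ln m - ln gibbs + real l * h"
  proof -
    have "ln (d * (gibbs * exp (- real l * h))) \<le> ln m"
      using dm d gibbs_pos m by (subst ln_le_cancel_iff) (auto simp: m_def)
    then show ?thesis using d gibbs_pos by (simp add: ln_mult)
  qed
  also have "ln (2 * c) \<le> ln 2 + ln K + real l * h"
  proof -
    have "ln c \<le> ln (K * exp (real l * h))"
      using card_words_le[of l] c K_pos by (subst ln_le_cancel_iff) (auto simp: c_def)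
    then show ?thesis using c K_pos by (simp add: ln_mult)
  qed
  finally have "real l * h \<le> q * (ln 2 + ln m - ln gibbs + real l * h) + (1 - q) * (ln 2 + ln K + real l * h)"
    using q1 by (simp add: mult_left_mono)
  \<comment> \<open>The terms \<open>real l * h\<close> have total weight
    \<open>q + (1 - q) = 1\<close> and cancel, so the bound does not depend on the window. The
    absolute values in \<open>bowen\<close> absorb the signs of the remaining logarithms.\<close>
  then have "- q * ln m \<le> ln 2 + q * (- ln gibbs) + (1 - q) * ln K"
    by (simp add: algebra_simps)
  also have "q * (- ln gibbs) \<le> \<bar>ln gibbs\<bar>" using q1 abs_le[of q "- ln gibbs"] by simp
  also have "(1 - q) * ln K \<le> \<bar>ln K\<bar>" using q1 by (intro abs_le) auto
  finally show "- measure Q (cyl X n l W) * ln (measure M (cyl X n l W)) \<le> bowen"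
    by (simp add: bowen_def q_def m_def)
qed

lemma maximal_entropy_absolutely_continuous:
  assumes Q: "measure_of_maximal_entropy A X Q" and E: "E \<in> sets M" and null: "measure M E = 0"
  shows "measure Q E = 0"
proof (rule ccontr)
  interpret Q: invariant_subshift A X Q
    using Q by unfold_locales (simp add: measure_of_maximal_entropy_def)
  define a where "a = measure Q E"
  assume "measure Q E \<noteq> 0"
  then have a: "0 < a" by (simp add: a_def zero_less_measure_iff)
  \<comment> \<open>The first bound keeps the mass of \<open>D\<close> under \<open>Q\<close> above
    \<open>a / 2\<close>. The second makes \<open>- ln (measure M D)\<close> at least
    \<open>2 * bowen / a + 1\<close>, so that the product exceeds \<open>bowen\<close>.\<close>
  define e where "e = min (a / 2) (exp (- (2 * bowen / a + 1)))"
  have e: "0 < e" using a by (simp add: e_def)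
  have fin: "finite_measure M" "finite_measure Q"
    by (rule finite_measureI, simp add: emeasure_space_1)
      (rule finite_measureI, simp add: Q.emeasure_space_1)
  obtain D where D: "D \<in> cyl_sets X" "measure M (sym_diff E D) < e" "measure Q (sym_diff E D) < e"
    using sigma_sets_approximation[OF algebra_cyl_sets fin(1) sets_M fin(2) Q.sets_M _ e] E sets_M
    by blast
  have sets: "D \<in> sets M" "D \<in> sets Q" "E \<in> sets Q"
    using D E cyl_sets_in_sets Q.cyl_sets_in_sets sets_M Q.sets_M by auto
  obtain n l W where DW: "D = cyl X n l W" using D by (auto simp: cyl_sets_def)
  have "measure M D \<le> measure M (E \<union> sym_diff E D)"
    using E sets by (intro finite_measure_mono) auto
  also have "\<dots> \<le> measure M E + measure M (sym_diff E D)"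
    using E sets by (intro measure_Un_le) auto
  finally have M_D: "measure M D < e" using null D by simp
  have "measure Q E \<le> measure Q (D \<union> sym_diff E D)"
    using E sets by (intro Q.finite_measure_mono) auto
  also have "\<dots> \<le> measure Q D + measure Q (sym_diff E D)"
    using E sets by (intro measure_Un_le) auto
  finally have Q_D: "a / 2 < measure Q D" using D by (simp add: a_def e_def)
  then have "0 < measure Q (cyl X n l W)" using a by (simp add: DW)
  note bound = maximal_entropy_cyl_bound[OF Q this, folded DW]
  have "ln (measure M D) \<le> ln (exp (- (2 * bowen / a + 1)))"
    using M_D bound(1) by (subst ln_le_cancel_iff) (auto simp: e_def)
  then have ln: "2 * bowen / a + 1 \<le> - ln (measure M D)" by simp
  have "bowen < a / 2 * (2 * bowen / a + 1)" using a by (simp add: field_simps)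
  also have "\<dots> \<le> measure Q D * (- ln (measure M D))"
    using Q_D ln a bowen_pos by (intro mult_mono) auto
  finally show False using bound(2) by simp
qed

lemma maximal_entropy_unique:
  assumes Q: "measure_of_maximal_entropy A X Q"
  shows "Q = M"
proof -
  interpret Q: invariant_subshift A X Q
    using Q by unfold_locales (simp add: measure_of_maximal_entropy_def)
  show ?thesis
  proof (rule ergodic_absolutely_continuous_unique[OF prob_space_M Q.prob_space_M _ shift_measurable])
    show "sets Q = sets M" by (simp add: sets_M Q.sets_M)
    show "measure M (shift -` E \<inter> space M) = measure M E" if "E \<in> sets M" for E
      using measure_shift[OF that] by (simp add: space_M)
    show "measure Q (shift -` E \<inter> space M) = measure Q E" if "E \<in> sets M" for E
      using Q.measure_shift[of E] that by (simp add: space_M sets_M Q.sets_M)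
    show "measure M E = 0 \<or> measure M E = 1"
      if "E \<in> sets M" "measure M (sym_diff E (shift -` E \<inter> space M)) = 0" for E
      using ergodic[OF that(1)] that(2) by (simp add: space_M)
    show "measure Q E = 0" if "E \<in> sets M" "measure M E = 0" for E
      using maximal_entropy_absolutely_continuous[OF Q that] .
  qed
qed

end

theorem corollary4p11:
  fixes A :: "'a set" and X :: "(int \<Rightarrow> 'a) set"
  assumes "finite A"
    and "shift_space A X"
    and "variable_specification X"
  shows "intrinsically_ergodic A X"
proof -
  obtain N where "\<forall>u\<in>language X. \<forall>v\<in>language X.
      \<exists>w\<in>language X. length w \<le> N \<and> u @ w @ v \<in> language X"
    using assms(3) by (auto simp: variable_specification_def)
  then interpret specified_subshift A X N
    using assms by unfold_locales auto
  obtain M where M: "invariant_measure A X M"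
    "\<And>n w. w \<in> words n X \<Longrightarrow> measure M (cylinder X w 0) \<le> K\<^sup>2 * exp (- real n * h)"
    "\<And>n w. w \<in> words n X \<Longrightarrow> gibbs * exp (- real n * h) \<le> measure M (cylinder X w 0)"
    using exists_gibbs_measure by blast
  interpret gibbs_subshift A X N M
    using M by unfold_locales
  show ?thesis
    unfolding intrinsically_ergodic_def
    using maximal_entropy maximal_entropy_unique by blast
qed

end
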